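(* Let $\Lambda\subset\mathbb R^d$ be a Bravais lattice and let $\mathcal Z_{G_1},\mathcal Z_{G_2}$ be semi-analytic graph lattice sums with representations $(a_\eta,\boldsymbol b_\eta,\boldsymbol\nu_\eta)$, $\boldsymbol b_\eta,\boldsymbol\nu_\eta\in\mathbb C^{N_\eta}$, $\eta\in\{1,2\}$, with $\mathrm{Re}(\nu_{i\eta})>d$ for all $i,\eta$. Let in addition $|a_\eta(\boldsymbol x)|\le C_\eta|\boldsymbol x|^{-\gamma_\eta}$ on $\Lambda\setminus\{\boldsymbol 0\}$ with $\gamma_\eta>d$ and $C_\eta>0$. Then $\mathcal Z_{G_1}\ast\mathcal Z_{G_2}$ is semi-analytic, with $$(\mathcal Z_{G_1}\ast\mathcal Z_{G_2})(\boldsymbol k)=\sum_{\boldsymbol x\in\Lambda}a_3(\boldsymbol x)\,e^{-2\pi i\boldsymbol x\cdot\boldsymbol k}+\sum_{i=1}^{N_1}\sum_{j=1}^{N_2}b_{i1}b_{j2}\,Z_{\Lambda,\nu_{i1}+\nu_{j2}}(\boldsymbol k),$$ with Fourier coefficients $$a_3(\boldsymbol x)=a_1(\boldsymbol x)a_2(\boldsymbol x)+a_1(\boldsymbol x)\sum_{j=1}^{N_2}b_{j2}\,\mathcal K_{\nu_{j2}}(\boldsymbol x)+a_2(\boldsymbol x)\sum_{i=1}^{N_1}b_{i1}\,\mathcal K_{\nu_{i1}}(\boldsymbol x).$$ The exponents of the Epstein zeta terms satisfy $\mathrm{Re}(\nu_{i1}+\nu_{j2})>2d>d$. The regular part $a_3$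 is even and obeys $|a_3(\boldsymbol x)|\le C_3|\boldsymbol x|^{-\gamma_3}$ on $\Lambda\setminus\{\boldsymbol 0\}$ for some $C_3>0$ with $$\gamma_3=\min\big(\gamma_1+\gamma_2,\ \gamma_1+\min_j\mathrm{Re}(\nu_{j2}),\ \gamma_2+\min_i\mathrm{Re}(\nu_{i1})\big),$$ with minima over empty index sets taken as $\infty$. In particular, $\gamma_3\ge d+2$ if $\gamma_1,\gamma_2\ge d+2$, so that semi-analyticity is preserved.
   Context: Lattice: $\Lambda=A\mathbb Z^d$ with $A\in\mathbb R^{d\times d}$ invertible, $V_\Lambda=|\det A|$, $\mathrm{BZ}=A^{-T}[0,1)^d$. Power-law kernel: $\mathcal K_\nu(\boldsymbol x)=|\boldsymbol x|^{-\nu}$ for $\boldsymbol x\neq\boldsymbol 0$, $\mathcal K_\nu(\boldsymbol 0)=0$. Epstein zeta function: $Z_{\Lambda,\nu}(\boldsymbol k)=\sum_{\boldsymbol x\in\Lambda}e^{-2\pi i\boldsymbol x\cdot\boldsymbol k}\mathcal K_\nu(\boldsymbol x)$ for $\mathrm{Re}(\nu)>d$. Convolution of integrable periodic functions on $\mathrm{BZ}$: $(f\ast g)(\boldsymbol k)=V_\Lambda\int_{\mathrm{BZ}}f(\boldsymbol k-\boldsymbol p)g(\boldsymbol p)\,\mathrm d\boldsymbol p$. Graph lattice sum of a finite connected multigraph $G=(V,E)$ with oriented edges $e=(e^-,e^+)$, $e^-\ne e^+$, kernels $K_e\in\ell^1(\Lambda)$ and terminals $s,t\in V$: $\mathcal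 Z_G(\boldsymbol k)=\sum_{\{\boldsymbol x_v\in\Lambda\}_{v\neq p}}e^{-2\pi i(\boldsymbol x_t-\boldsymbol x_s)\cdot\boldsymbol k}\prod_{e\in E}K_e(\boldsymbol x_{e^+}-\boldsymbol x_{e^-})$, with an arbitrary pinned node $p$ at fixed position. Semi-analytic: a kernel $K\in\ell^1(\Lambda)$ is semi-analytic if it admits a representation $K(\boldsymbol x)=a(\boldsymbol x)+\sum_{j=1}^N b_j\mathcal K_{\nu_j}(\boldsymbol x)$ with $N\in\mathbb N_0$, $b_j,\nu_j\in\mathbb C$, $\mathrm{Re}(\nu_j)>d$, and $a:\Lambda\to\mathbb C$ even with $|a(\boldsymbol x)|\le C|\boldsymbol x|^{-(d+2)}$ for all $\boldsymbol x\in\Lambda\setminus\{\boldsymbol 0\}$ and some $C>0$. The representation is denoted $(a,\boldsymbol b,\boldsymbol\nu)$; it is not unique, and the statement refers to given representations. A graph lattice sum $\mathcal Z_G$ is semi-analytic if it is the lattice Fourier transform of a semi-analytic kernel, i.e. $\mathcal Z_G(\boldsymbol k)=\sum_{\boldsymbol x\in\Lambda}a(\boldsymbol x)e^{-2\pi i\boldsymbol x\cdot\boldsymbol k}+\sum_{j=1}^N b_jZ_{\Lambda,\nu_j}(\boldsymbol k)$. *)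

theory Defs
  imports "HOL-Analysis.Analysis" "Graph_Theory.Digraph_Component"
begin

text \<open>
  The dimension d is \<open>CARD('n)\<close>; a lattice is given by its invertible generator matrix A.
\<close>

definition lattice :: "real^'n^'n \<Rightarrow> (real^'n) set" where
  "lattice A = {A *v z | z. \<forall>i. z $ i \<in> \<int>}"

definition cell_volume :: "real^'n^'n \<Rightarrow> real" where
  "cell_volume A = \<bar>det A\<bar>"

definition BZ :: "real^'n^'n \<Rightarrow> (real^'n) set" where
  "BZ A = {transpose (matrix_inv A) *v u | u. \<forall>i. 0 \<le> u $ i \<and> u $ i < 1}"

definition power_kernel :: "complex \<Rightarrow> real^'n \<Rightarrow> complex" where
  "power_kernel \<nu> x = (if x = 0 then 0 else of_real (norm x) powr (- \<nu>))"

definition lattice_char :: "real^'n \<Rightarrow> real^'n \<Rightarrow> complex" where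
  "lattice_char k x = exp (- 2 * of_real pi * \<i> * of_real (x \<bullet> k))"

definition lattice_fourier :: "real^'n^'n \<Rightarrow> (real^'n \<Rightarrow> complex) \<Rightarrow> real^'n \<Rightarrow> complex" where
  "lattice_fourier A K k = (\<Sum>\<^sub>\<infinity>x\<in>lattice A. K x * lattice_char k x)"

definition epstein_zeta :: "real^'n^'n \<Rightarrow> complex \<Rightarrow> real^'n \<Rightarrow> complex" where
  "epstein_zeta A \<nu> k = (\<Sum>\<^sub>\<infinity>x\<in>lattice A. lattice_char k x * power_kernel \<nu> x)"

definition BZ_convolution ::
    "real^'n^'n \<Rightarrow> (real^'n \<Rightarrow> complex) \<Rightarrow> (real^'n \<Rightarrow> complex) \<Rightarrow> real^'n \<Rightarrow> complex" where
  "BZ_convolution A f g k =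
     of_real (cell_volume A) * (LINT p:BZ A|lborel. f (k - p) * g p)"

definition l1_kernel :: "real^'n^'n \<Rightarrow> (real^'n \<Rightarrow> complex) \<Rightarrow> bool" where
  "l1_kernel A K \<longleftrightarrow> (\<lambda>x. norm (K x)) summable_on lattice A"

text \<open>
  An oriented edge e runs from \<open>tail G e\<close> (written \<open>e\<close> with superscript minus in the
  usual notation) to \<open>head G e\<close> (superscript plus).  Parallel and antiparallel edges are allowed.
  The predicate \<open>Digraph_Component.connected\<close> is connectedness of the underlying undirected graph.
\<close>

definition kernel_graph ::
    "real^'n^'n \<Rightarrow> ('v, 'e) pre_digraph \<Rightarrow> ('e \<Rightarrow> real^'n \<Rightarrow> complex)
      \<Rightarrow> 'v \<Rightarrow> 'v \<Rightarrow> bool" where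
  "kernel_graph A G K s t \<longleftrightarrow>
     fin_digraph G \<and> loopfree_digraph G \<and> Digraph_Component.connected G \<and>
     (\<forall>e\<in>arcs G. l1_kernel A (K e)) \<and> s \<in> verts G \<and> t \<in> verts G"

text \<open>
  The vertex p is pinned at the position y, and the sum runs over the positions of
  all other vertices; \<open>x(p := y)\<close> is the resulting placement of all vertices.
\<close>

definition graph_lattice_sum ::
    "real^'n^'n \<Rightarrow> ('v, 'e) pre_digraph \<Rightarrow> ('e \<Rightarrow> real^'n \<Rightarrow> complex)
      \<Rightarrow> 'v \<Rightarrow> 'v \<Rightarrow> 'v \<Rightarrow> real^'n \<Rightarrow> real^'n \<Rightarrow> complex" where
  "graph_lattice_sum A G K s t p y k =
     (\<Sum>\<^sub>\<infinity>x \<in> (verts G - {p}) \<rightarrow>\<^sub>E lattice A.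
        let X = x(p := y) in
          lattice_char k (X t - X s) * (\<Prod>e\<in>arcs G. K e (X (head G e) - X (tail G e))))"

text \<open>
  Natural numbers as vertices and edges are no restriction, since the graphs are finite.
\<close>

definition is_graph_lattice_sum :: "real^'n^'n \<Rightarrow> (real^'n \<Rightarrow> complex) \<Rightarrow> bool" where
  "is_graph_lattice_sum A Z \<longleftrightarrow>
     (\<exists>(G :: (nat, nat) pre_digraph) K s t.
        kernel_graph A G K s t \<and>
        (\<forall>p\<in>verts G. \<forall>y\<in>lattice A. \<forall>k. Z k = graph_lattice_sum A G K s t p y k))"

definition even_on_lattice :: "real^'n^'n \<Rightarrow> (real^'n \<Rightarrow> complex) \<Rightarrow> bool" where
  "even_on_lattice A a \<longleftrightarrow> (\<forall>x\<in>lattice A. a (- x) = a x)"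

text \<open>The complex vectors b and \<open>\<nu>\<close> of length N are functions restricted to \<open>{1..N}\<close>.\<close>

definition kernel_representation ::
    "real^'n^'n \<Rightarrow> (real^'n \<Rightarrow> complex)
      \<Rightarrow> (real^'n \<Rightarrow> complex) \<Rightarrow> nat \<Rightarrow> (nat \<Rightarrow> complex) \<Rightarrow> (nat \<Rightarrow> complex) \<Rightarrow> bool" where
  "kernel_representation A K a N b \<nu> \<longleftrightarrow>
     (\<forall>x\<in>lattice A. K x = a x + (\<Sum>j=1..N. b j * power_kernel (\<nu> j) x)) \<and>
     (\<forall>j\<in>{1..N}. Re (\<nu> j) > real CARD('n)) \<and>
     even_on_lattice A a \<and>
     (\<exists>C>0. \<forall>x\<in>lattice A - {0}. norm (a x) \<le> C * norm x powr (- (real CARD('n) + 2)))"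

definition semi_analytic_kernel :: "real^'n^'n \<Rightarrow> (real^'n \<Rightarrow> complex) \<Rightarrow> bool" where
  "semi_analytic_kernel A K \<longleftrightarrow>
     l1_kernel A K \<and> (\<exists>a N b \<nu>. kernel_representation A K a N b \<nu>)"

text \<open>
  A function Z is the lattice Fourier transform of a kernel with the given representation.
\<close>

definition fourier_representation ::
    "real^'n^'n \<Rightarrow> (real^'n \<Rightarrow> complex)
      \<Rightarrow> (real^'n \<Rightarrow> complex) \<Rightarrow> nat \<Rightarrow> (nat \<Rightarrow> complex) \<Rightarrow> (nat \<Rightarrow> complex) \<Rightarrow> bool" where
  "fourier_representation A Z a N b \<nu> \<longleftrightarrow>
     (\<exists>K. l1_kernel A K \<and> kernel_representation A K a N b \<nu> \<and> (\<forall>k. Z k = lattice_fourier A K k))"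

definition semi_analytic_sum :: "real^'n^'n \<Rightarrow> (real^'n \<Rightarrow> complex) \<Rightarrow> bool" where
  "semi_analytic_sum A Z \<longleftrightarrow>
     is_graph_lattice_sum A Z \<and>
     (\<exists>K. semi_analytic_kernel A K \<and> (\<forall>k. Z k = lattice_fourier A K k))"

end

theory Submission
  imports Defs
begin

text \<open>
  A convolution over the Brillouin zone of two lattice Fourier series is the Fourier series of the
  pointwise product of the coefficients.  So if \<open>L\<^sub>1\<close> and \<open>L\<^sub>2\<close> are the kernels behind the two given
  sums, the convolution is the Fourier transform of \<open>L\<^sub>1 L\<^sub>2\<close>.  Everything asserted is then read off
  from this single product: since \<open>\<bar>x\<bar>\<close>-powers multiply by adding exponents, the product
  of the two power-law parts is the double sum of kernels with exponents \<open>\<nu>\<^sub>1\<^sub>i + \<nu>\<^sub>2\<^sub>j\<close>, and the three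
  remaining terms form \<open>a\<^sub>3\<close>.

  The convolution formula (\<open>BZ_convolution_lattice_fourier\<close>) needs two things.  The series
  may be integrated term by term, because the coefficients are absolutely summable and characters are
  bounded (\<open>has_sum_set_integral\<close>).  And the characters of the lattice are orthogonal on the
  Brillouin zone (\<open>BZ_character_orthogonality\<close>): the matrix \<open>A\<^sup>-\<^sup>T\<close> maps the unit cube onto the
  zone and turns the lattice character of \<open>Az\<close> into the standard character of the integer vector
  \<open>z\<close>, whose integral over the cube factorises.  The substitution multiplies volumes by
  \<open>1 / \<bar>det A\<bar>\<close>, which the prefactor of the convolution cancels; it rests on the determinant rule
  for Lebesgue measure, obtained in \<open>lborel_distr_linear\<close> by splitting a linear map into elementary ones.

  Splitting the Fourier series of \<open>L\<^sub>1 L\<^sub>2\<close> into a regular part and Epstein zeta functions is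
  legitimate because every power-law kernel with exponent beyond the dimension is absolutely summable
  on the lattice (\<open>lattice_powr_summable\<close>).  The decay of \<open>a\<^sub>3\<close> follows from a small calculus of
  decay rates: rates add under products, and a rate may be lowered because nonzero
  lattice vectors stay away from the origin.  That calculus is applied twice, once with the given rates
  \<open>\<gamma>\<^sub>1, \<gamma>\<^sub>2\<close> and once with the rate \<open>d + 2\<close> that the definition of a representation provides.

  Finally, the convolution is again a graph lattice sum: any summable kernel \<open>K\<close> can be placed
  on a single edge from source to target, and the resulting sum is the Fourier transform of
  \<open>K\<close>.  For \<open>K = L\<^sub>1 L\<^sub>2\<close> this edge stands for two parallel edges carrying \<open>L\<^sub>1\<close> and \<open>L\<^sub>2\<close>.
\<close>

section \<open>Lattice vectors\<close>

lemma lattice_diff: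
  assumes "x \<in> lattice A" "y \<in> lattice A"
  shows "x - y \<in> lattice A"
proof -
  from assms obtain u v where "x = A *v u" "y = A *v v" "\<forall>i. u $ i \<in> \<int>" "\<forall>i. v $ i \<in> \<int>"
    by (auto simp: lattice_def)
  then have "x - y = A *v (u - v)" "\<forall>i. (u - v) $ i \<in> \<int>"
    by (auto simp: matrix_vector_mult_diff_distrib)
  then show ?thesis
    unfolding lattice_def by blast
qed

lemma zero_in_lattice: "0 \<in> lattice A"
  unfolding lattice_def by (auto intro!: exI[of _ 0])

lemma lattice_uminus: "x \<in> lattice A \<Longrightarrow> - x \<in> lattice A"
  using lattice_diff[OF zero_in_lattice, of x A] by simp

lemma lattice_add: "x \<in> lattice A \<Longrightarrow> y \<in> lattice A \<Longrightarrow> x + y \<in> lattice A"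
  using lattice_diff[of x A "- y"] lattice_uminus[of y A] by simp

lemma invertible_imp_inj:
  fixes A :: "real^'n^'n"
  assumes "invertible A"
  shows "inj ((*v) A)"
  using assms by (metis invertible_def matrix_left_invertible_injective)

text \<open>
  Nonzero lattice vectors stay away from the origin: a nonzero integer vector has an entry of modulus
  at least one, and an injective linear map shrinks norms by at most a constant factor.
\<close>

lemma lattice_norm_bounded_below:
  fixes A :: "real^'n^'n"
  assumes "invertible A"
  obtains c where "c > 0" and "\<And>z. \<forall>i. z $ i \<in> \<int> \<Longrightarrow> z \<noteq> 0 \<Longrightarrow> 1 \<le> norm z \<and> c * norm z \<le> norm (A *v z)"
proof -
  have "inj ((*v) A)"
    using assms by (rule invertible_imp_inj)
  then obtain c where c: "c > 0" "\<And>z. c * norm z \<le> norm (A *v z)"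
    using linear_inj_bounded_below_pos[of "(*v) A"] matrix_vector_mul_linear by blast
  have "1 \<le> norm z" if z: "\<forall>i. z $ i \<in> \<int>" "z \<noteq> 0" for z :: "real^'n"
  proof -
    obtain i where "z $ i \<noteq> 0"
      using z(2) by (auto simp: vec_eq_iff)
    then have "1 \<le> \<bar>z $ i\<bar>"
      using z(1) Ints_nonzero_abs_ge1 by blast
    then show ?thesis
      using component_le_norm_cart[of z i] by linarith
  qed
  with c show ?thesis
    using that by blast
qed

section \<open>Lebesgue measure under invertible linear maps\<close>

lemma Basis_cart: "(Basis :: (real^'n) set) = range (\<lambda>i. axis i 1)"
  by (auto simp: Basis_vec_def)

lemma prod_Basis_cart:
  "(\<Prod>b\<in>(Basis :: (real^'n) set). g b) = (\<Prod>i\<in>UNIV. g (axis i 1))"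
  unfolding Basis_cart by (subst prod.reindex) (auto simp: inj_on_def axis_eq_axis)

lemma emeasure_lborel_box_cart:
  fixes l u :: "real^'n"
  assumes "\<And>i. l $ i \<le> u $ i"
  shows "emeasure lborel (box l u) = ennreal (\<Prod>i\<in>UNIV. u $ i - l $ i)"
proof -
  have "l \<bullet> b \<le> u \<bullet> b" if "b \<in> Basis" for b
    using that assms by (auto simp: Basis_cart inner_axis)
  then show ?thesis
    by (simp add: prod_Basis_cart inner_axis)
qed

lemma lborel_eqI_cart:
  fixes M :: "(real^'n) measure"
  assumes "\<And>l u. (\<And>i. l $ i \<le> u $ i) \<Longrightarrow>
             emeasure M (box l u) = ennreal (\<Prod>i\<in>UNIV. u $ i - l $ i)"
    and "sets M = sets borel"
  shows "lborel = M"
proof (rule lborel_eqI)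
  fix l u :: "real^'n"
  assume le: "\<And>b. b \<in> Basis \<Longrightarrow> l \<bullet> b \<le> u \<bullet> b"
  have "l $ i \<le> u $ i" for i
    using le[of "axis i 1"] by (simp add: Basis_cart inner_axis)
  then show "emeasure M (box l u) = ennreal (\<Prod>b\<in>Basis. (u - l) \<bullet> b)"
    by (simp add: assms(1) prod_Basis_cart inner_axis)
qed (rule assms)

lemma borel_measurable_vec_lambda_PiM:
  "(\<lambda>f. \<chi> i. f i) \<in> (\<Pi>\<^sub>M i\<in>(UNIV::'n::finite set). lborel :: real measure) \<rightarrow>\<^sub>M borel"
proof (subst borel_measurable_euclidean_space, intro ballI)
  fix b :: "real^'n" assume "b \<in> Basis"
  then obtain i where "b = axis i 1"
    by (auto simp: Basis_cart)
  then show "(\<lambda>f. (\<chi> i. f i) \<bullet> b) \<in> borel_measurable (\<Pi>\<^sub>M i\<in>(UNIV::'n set). lborel)"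
    by (simp add: inner_axis)
qed

text \<open>
  On vectors indexed by a finite type, Lebesgue measure is the product measure over the index type.
  This form, unlike the one over \<open>Basis\<close>, permits Fubini in a chosen coordinate.
\<close>

lemma lborel_cart:
  "(lborel :: (real^'n) measure) = distr (\<Pi>\<^sub>M i\<in>UNIV. lborel) borel (\<lambda>f. \<chi> i. f i)"
proof (rule lborel_eqI_cart)
  interpret product_sigma_finite "\<lambda>_::'n. lborel :: real measure"
    by standard
  note [measurable] = borel_measurable_vec_lambda_PiM
  fix l u :: "real^'n" assume le: "\<And>i. l $ i \<le> u $ i"
  have "(\<lambda>f. \<chi> i. f i) -` box l u \<inter> space (\<Pi>\<^sub>M i\<in>(UNIV::'n set). lborel)
      = (\<Pi>\<^sub>E i\<in>UNIV. {l $ i <..< u $ i})"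
    by (auto simp: space_PiM mem_box_cart PiE_UNIV_domain Pi_iff)
  then show "emeasure (distr (\<Pi>\<^sub>M i\<in>UNIV. lborel) borel (\<lambda>f. \<chi> i. f i)) (box l u)
      = ennreal (\<Prod>i\<in>UNIV. u $ i - l $ i)"
    using le by (simp add: emeasure_distr emeasure_PiM prod_ennreal)
qed simp

lemma borel_measurable_linear_cart:
  fixes f :: "real^'n \<Rightarrow> real^'m"
  assumes "linear f" shows "f \<in> borel_measurable borel"
  using assms by (simp add: borel_measurable_continuous_onI linear_continuous_on linear_conv_bounded_linear)

lemma lborel_distr_swap:
  fixes m n :: "'n::finite"
  defines "f \<equiv> \<lambda>x::real^'n. \<chi> i. x $ Transposition.transpose m n i"
  shows "lborel = distr lborel borel f"
proof (rule lborel_eqI_cart)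
  fix l u :: "real^'n" assume le: "\<And>i. l $ i \<le> u $ i"
  have lin: "linear f"
    unfolding f_def by (rule linearI) (auto simp: vec_eq_iff)
  have "f x \<in> box l u \<longleftrightarrow> x \<in> box (f l) (f u)" for x
  proof -
    have "(\<forall>i. P i) \<longleftrightarrow> (\<forall>i. P (Transposition.transpose m n i))" for P :: "'n \<Rightarrow> bool"
      by (metis transpose_involutory)
    from this[of "\<lambda>i. l $ Transposition.transpose m n i < x $ i \<and> x $ i < u $ Transposition.transpose m n i"]
    show ?thesis
      by (simp add: f_def mem_box_cart)
  qed
  then have "f -` box l u = box (f l) (f u)"
    by auto
  then have "emeasure (distr lborel borel f) (box l u) = emeasure lborel (box (f l) (f u))"
    by (simp add: emeasure_distr borel_measurable_linear_cart lin)
  also have "\<dots> = ennreal (\<Prod>i\<in>UNIV. f u $ i - f l $ i)"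
    by (rule emeasure_lborel_box_cart) (use le in \<open>auto simp: f_def\<close>)
  also have "(\<Prod>i\<in>UNIV. f u $ i - f l $ i) = (\<Prod>i\<in>UNIV. u $ i - l $ i)"
    unfolding f_def
    using prod.permute[of "Transposition.transpose m n" UNIV "\<lambda>i. u $ i - l $ i"]
    by (simp add: permutes_swap_id o_def)
  finally show "emeasure (distr lborel borel f) (box l u) = ennreal (\<Prod>i\<in>UNIV. u $ i - l $ i)" .
qed simp

text \<open>
  A shear translates the coordinate \<open>m\<close> by an amount that depends only on the other coordinates.
  Integrating over the coordinate \<open>m\<close> first, the translation disappears.
\<close>

lemma lborel_distr_shear:
  fixes m n :: "'n::finite"
  assumes "m \<noteq> n"
  defines "f \<equiv> \<lambda>x::real^'n. \<chi> i. if i = m then x $ m + x $ n else x $ i"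
  shows "lborel = distr lborel borel f"
proof (rule lborel_eqI_cart)
  interpret product_sigma_finite "\<lambda>_::'n. lborel :: real measure"
    by standard
  define I where "I = UNIV - {m}"
  have I: "UNIV = insert m I" "m \<notin> I" "finite I"
    by (auto simp: I_def)
  have lin: "linear f"
    unfolding f_def by (rule linearI) (auto simp: vec_eq_iff algebra_simps)
  note [measurable] = borel_measurable_linear_cart[OF lin]
  note [measurable] = borel_measurable_vec_lambda_PiM
  fix l u :: "real^'n" assume le: "\<And>i. l $ i \<le> u $ i"
  let ?J = "\<lambda>i. indicator {l $ i <..< u $ i} :: real \<Rightarrow> ennreal"
  have ind: "indicator (box l u) (f (\<chi> i. (x(m := y)) i)) = ?J m (y + x n) * (\<Prod>i\<in>I. ?J i (x i))"
    for x y
  proof -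
    have "f (\<chi> i. (x(m := y)) i) \<in> box l u \<longleftrightarrow>
        y + x n \<in> {l $ m <..< u $ m} \<and> (\<forall>i\<in>I. x i \<in> {l $ i <..< u $ i})"
      using \<open>m \<noteq> n\<close> by (auto simp: f_def mem_box_cart I_def)
    then show ?thesis
      using I(3) by (auto simp: indicator_def prod_zero_iff)
  qed
  have "emeasure (distr lborel borel f) (box l u) = (\<integral>\<^sup>+x. indicator (box l u) (f x) \<partial>lborel)"
    by (simp flip: nn_integral_indicator add: nn_integral_distr)
  also have "\<dots> = (\<integral>\<^sup>+x. indicator (box l u) (f (\<chi> i. x i)) \<partial>(\<Pi>\<^sub>M i\<in>UNIV. lborel))"
    by (subst lborel_cart) (simp add: nn_integral_distr)
  also have "\<dots> = (\<integral>\<^sup>+x. \<integral>\<^sup>+y. indicator (box l u) (f (\<chi> i. (x(m := y)) i)) \<partial>lborel \<partial>(\<Pi>\<^sub>M i\<in>I. lborel))"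
    unfolding I(1) by (rule product_nn_integral_insert[OF I(3,2)]) (simp flip: I(1))
  also have "\<dots> = (\<integral>\<^sup>+x. ennreal (u $ m - l $ m) * (\<Prod>i\<in>I. ?J i (x i)) \<partial>(\<Pi>\<^sub>M i\<in>I. lborel))"
  proof (rule nn_integral_cong)
    fix x :: "'n \<Rightarrow> real"
    have "(\<integral>\<^sup>+y. ?J m (x n + y) \<partial>lborel) = ennreal (u $ m - l $ m)"
      using nn_integral_real_affine[of "?J m" 1 "x n"] le by simp
    then show "(\<integral>\<^sup>+y. indicator (box l u) (f (\<chi> i. (x(m := y)) i)) \<partial>lborel)
        = ennreal (u $ m - l $ m) * (\<Prod>i\<in>I. ?J i (x i))"
      unfolding ind by (subst nn_integral_multc) (auto simp: add.commute)
  qed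
  also have "\<dots> = ennreal (u $ m - l $ m) * (\<Prod>i\<in>I. ennreal (u $ i - l $ i))"
    using le I(3) product_nn_integral_prod[of I ?J] by (simp add: nn_integral_cmult)
  also have "\<dots> = ennreal (\<Prod>i\<in>UNIV. u $ i - l $ i)"
    using le prod.remove[of UNIV m "\<lambda>i. u $ i - l $ i"]
    by (simp add: prod_ennreal ennreal_mult' prod_nonneg I_def)
  finally show "emeasure (distr lborel borel f) (box l u) = ennreal (\<Prod>i\<in>UNIV. u $ i - l $ i)" .
qed simp

text \<open>
  The image of Lebesgue measure under the stretch is thinned out by the factor by which volumes grow,
  so the density restores it.
\<close>

lemma lborel_distr_stretch:
  fixes c :: "'n::finite \<Rightarrow> real"
  assumes c: "\<And>i. c i \<noteq> 0"
  shows "lborel = density (distr lborel borel (\<lambda>x::real^'n. \<chi> i. c i * x $ i)) (\<lambda>_. \<bar>\<Prod>i\<in>UNIV. c i\<bar>)"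
proof -
  have eq: "(0::real^'n) + (\<Sum>j\<in>Basis. (((\<chi> i. c i) \<bullet> j) * (x \<bullet> j)) *\<^sub>R j) = (\<chi> i. c i * x $ i)" for x
  proof -
    have "(\<Sum>j\<in>Basis. (((\<chi> i. c i) \<bullet> j) * (x \<bullet> j)) *\<^sub>R j) = (\<Sum>i\<in>UNIV. (c i * x $ i) *\<^sub>R axis i 1)"
      unfolding Basis_cart by (subst sum.reindex) (auto simp: inj_on_def axis_eq_axis inner_axis)
    then show ?thesis
      by (simp add: vec_eq_iff axis_def if_distrib cong: if_cong)
  qed
  have "(\<chi> i. c i) \<bullet> j \<noteq> 0" if "j \<in> Basis" for j
    using that c by (auto simp: Basis_cart inner_axis)
  from lborel_affine_euclidean[of "\<lambda>b. (\<chi> i. c i) \<bullet> b" "0::real^'n", OF this] show ?thesis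
    unfolding eq by (simp add: prod_Basis_cart inner_axis abs_prod)
qed

text \<open>
  The property is multiplicative in the linear map, as the determinant is.  It therefore suffices to
  check coordinate stretches, swaps and shears, which generate all invertible maps; the remaining
  generators, those that annihilate a coordinate, have determinant zero.
\<close>

proposition lborel_distr_linear:
  fixes f :: "real^'n \<Rightarrow> real^'n"
  assumes "linear f" and "det (matrix f) \<noteq> 0"
  shows "lborel = density (distr lborel borel f) (\<lambda>_. ennreal \<bar>det (matrix f)\<bar>)"
proof -
  define P where "P f \<longleftrightarrow> (det (matrix f) \<noteq> 0 \<longrightarrow>
      lborel = density (distr lborel borel f) (\<lambda>_. ennreal \<bar>det (matrix f)\<bar>))"
    for f :: "real^'n \<Rightarrow> real^'n"
  have "P f"
  proof (rule induct_linear_elementary[OF assms(1), of P])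
    fix f g :: "real^'n \<Rightarrow> real^'n"
    assume lin: "linear f" "linear g" and P: "P f" "P g"
    note [measurable] = borel_measurable_linear_cart[OF lin(1)] borel_measurable_linear_cart[OF lin(2)]
    have det: "det (matrix (f \<circ> g)) = det (matrix f) * det (matrix g)"
      using lin by (simp add: matrix_compose det_mul)
    show "P (f \<circ> g)"
      unfolding P_def
    proof
      assume "det (matrix (f \<circ> g)) \<noteq> 0"
      then have f: "lborel = density (distr lborel borel f) (\<lambda>_. ennreal \<bar>det (matrix f)\<bar>)"
        and g: "lborel = density (distr lborel borel g) (\<lambda>_. ennreal \<bar>det (matrix g)\<bar>)"
        using P det by (auto simp: P_def)
      have "density (distr lborel borel (f \<circ> g)) (\<lambda>_. ennreal \<bar>det (matrix (f \<circ> g))\<bar>)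
          = density (distr (density (distr lborel borel g) (\<lambda>_. ennreal \<bar>det (matrix g)\<bar>)) borel f)
              (\<lambda>_. ennreal \<bar>det (matrix f)\<bar>)"
      proof (rule measure_eqI)
        fix X assume "X \<in> sets (density (distr lborel borel (f \<circ> g)) (\<lambda>_. ennreal \<bar>det (matrix (f \<circ> g))\<bar>))"
        then have [measurable]: "X \<in> sets borel"
          by simp
        then have [measurable]: "f -` X \<in> sets borel"
          using measurable_sets_borel[OF borel_measurable_linear_cart[OF lin(1)]] by simp
        have dist: "distr lborel borel (f \<circ> g) = distr (distr lborel borel g) borel f"
          by (simp add: distr_distr)
        show "emeasure (density (distr lborel borel (f \<circ> g)) (\<lambda>_. ennreal \<bar>det (matrix (f \<circ> g))\<bar>)) X =
          emeasure (density (distr (density (distr lborel borel g) (\<lambda>_. ennreal \<bar>det (matrix g)\<bar>)) borel f)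
              (\<lambda>_. ennreal \<bar>det (matrix f)\<bar>)) X"
          unfolding dist
          by (simp add: emeasure_density_const emeasure_distr det abs_mult ennreal_mult mult.assoc)
      qed simp
      also have "\<dots> = lborel"
        using f g by simp
      finally show "lborel = density (distr lborel borel (f \<circ> g)) (\<lambda>_. ennreal \<bar>det (matrix (f \<circ> g))\<bar>)"
        by simp
    qed
  next
    fix f :: "real^'n \<Rightarrow> real^'n" and i
    assume lin: "linear f" and zero: "\<And>x. f x $ i = 0"
    have "axis i 1 \<notin> range f"
      using zero by (auto simp: axis_def vec_eq_iff image_iff)
    then have "\<not> inj f"
      using linear_injective_imp_surjective[OF lin] by auto
    then show "P f"
      using lin det_nz_iff_inj by (auto simp: P_def)
  next
    fix c :: "'n \<Rightarrow> real"
    have "matrix (\<lambda>x::real^'n. \<chi> i. c i * x $ i) = (\<chi> i j. if i = j then c i else 0)"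
      by (auto simp: matrix_def axis_def vec_eq_iff)
    then have det: "det (matrix (\<lambda>x::real^'n. \<chi> i. c i * x $ i)) = (\<Prod>i\<in>UNIV. c i)"
      by (simp add: det_diagonal)
    show "P (\<lambda>x. \<chi> i. c i * x $ i)"
      unfolding P_def det using lborel_distr_stretch[of c] by auto
  next
    fix m n :: 'n assume "m \<noteq> n"
    have lin: "linear (\<lambda>x::real^'n. \<chi> i. x $ Transposition.transpose m n i)"
      by (rule linearI) (auto simp: vec_eq_iff)
    have "matrix (\<lambda>x::real^'n. \<chi> i. x $ Transposition.transpose m n i)
        = ((\<chi> i. mat 1 $ Transposition.transpose m n i) :: real^'n^'n)"
      by (auto simp: matrix_def mat_def axis_def vec_eq_iff)
    moreover have "det ((\<chi> i. mat 1 $ Transposition.transpose m n i) :: real^'n^'n) =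
        of_int (sign (Transposition.transpose m n)) * det (mat 1 :: real^'n^'n)"
      by (intro det_permute_rows permutes_swap_id) auto
    ultimately have "\<bar>det (matrix (\<lambda>x::real^'n. \<chi> i. x $ Transposition.transpose m n i))\<bar> = 1"
      by (simp add: sign_def)
    then show "P (\<lambda>x. \<chi> i. x $ Transposition.transpose m n i)"
      unfolding P_def using lborel_distr_swap[of m n] by (simp add: density_1)
  next
    fix m n :: 'n assume mn: "m \<noteq> n"
    let ?f = "\<lambda>x::real^'n. \<chi> i. if i = m then x $ m + x $ n else x $ i"
    have "matrix ?f = (\<chi> i. if i = m then row m (mat 1) + 1 *s row n (mat 1) else row i (mat 1))"
      using mn by (auto simp: matrix_def mat_def axis_def row_def vec_eq_iff)
    then have "det (matrix ?f) = det (mat 1 :: real^'n^'n)"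
      using det_row_operation[OF mn, of "mat 1 :: real^'n^'n" 1] by simp
    then show "P ?f"
      unfolding P_def using lborel_distr_shear[OF mn] by (simp add: density_1)
  qed
  then show ?thesis
    using assms by (simp add: P_def)
qed

section \<open>Orthogonality of characters on the Brillouin zone\<close>

lemma norm_lattice_char [simp]: "norm (lattice_char k x) = 1"
  by (simp add: lattice_char_def norm_exp_eq_Re)

lemma lattice_char_add_left: "lattice_char (k + p) x = lattice_char k x * lattice_char p x"
  by (simp add: lattice_char_def inner_add_right exp_add[symmetric] ring_distribs)

lemma lattice_char_diff_right: "lattice_char k (y - x) = lattice_char k y * lattice_char (- k) x"
  by (simp add: lattice_char_def inner_diff_left exp_add[symmetric] ring_distribs)

lemma continuous_on_lattice_char [continuous_intros]: "continuous_on S (\<lambda>k. lattice_char k x)"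
  unfolding lattice_char_def by (intro continuous_intros)

lemma borel_measurable_lattice_char [measurable]: "(\<lambda>k. lattice_char k x) \<in> borel_measurable borel"
  by (intro borel_measurable_continuous_onI continuous_intros)

text \<open>
  For \<open>z \<noteq> 0\<close> the primitive \<open>exp (c u) / c\<close> takes the same value at both ends, as \<open>c\<close> is an
  integer multiple of \<open>2 \<pi> \<i>\<close>.
\<close>

lemma has_bochner_integral_character_Ico:
  fixes z :: real
  assumes "z \<in> \<int>"
  shows "has_bochner_integral lborel
           (\<lambda>u. indicator {0..<1} u *\<^sub>R exp (- 2 * of_real pi * \<i> * of_real (z * u)))
           (if z = 0 then 1 else 0 :: complex)"
proof -
  define c where "c = - 2 * of_real pi * \<i> * of_real z"
  have eq: "- 2 * of_real pi * \<i> * of_real (z * u) = c * of_real u" for u :: real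
    by (simp add: c_def)
  have "has_bochner_integral lborel (\<lambda>u. indicator {0..1} u *\<^sub>R exp (c * of_real u))
          (if z = 0 then 1 else 0 :: complex)"
  proof (cases "z = 0")
    case True
    have "(complex_of_real has_vector_derivative 1) (at x within {0..1})" for x
      using has_vector_derivative_real_field[OF DERIV_ident] .
    then have "has_bochner_integral lborel (\<lambda>u::real. indicator {0..1} u *\<^sub>R 1)
        (complex_of_real 1 - complex_of_real 0)"
      by (intro has_bochner_integral_FTC_Icc[where F = complex_of_real and f = "\<lambda>_. 1" and a = 0 and b = 1]) auto
    with True show ?thesis
      by (simp add: c_def)
  next
    case False
    then have c: "c \<noteq> 0"
      by (simp add: c_def)
    have e: "exp c = 1"
    proof -
      obtain m where "z = of_int m"
        using assms by (elim Ints_cases)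
      then show ?thesis
        by (auto simp: c_def exp_eq_1 intro!: exI[of _ "- m"])
    qed
    have "((\<lambda>u. exp (c * of_real u) / c) has_vector_derivative exp (c * of_real u)) (at u within {0..1})"
      for u :: real
    proof -
      have "((\<lambda>w. exp (c * w) / c) has_field_derivative exp (c * of_real u)) (at (of_real u))"
        using c by (auto intro!: derivative_eq_intros)
      from has_vector_derivative_real_field[OF this] show ?thesis .
    qed
    then have "has_bochner_integral lborel (\<lambda>u. indicator {0..1} u *\<^sub>R exp (c * of_real u))
        (exp (c * of_real 1) / c - exp (c * of_real 0) / c)"
      by (intro has_bochner_integral_FTC_Icc) (auto intro!: continuous_intros)
    then show ?thesis
      using False e by simp
  qed
  moreover have "AE u in lborel. indicator {0..1} u *\<^sub>R exp (c * of_real u)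
      = indicator {0..<1::real} u *\<^sub>R (exp (c * of_real u) :: complex)"
    using AE_lborel_singleton[of "1::real"] by eventually_elim (auto simp: indicator_def)
  ultimately show ?thesis
    unfolding eq by (subst has_bochner_integral_cong_AE[symmetric]) auto
qed

text \<open>
  The integrand is a product of functions of one coordinate each, so the integral is a product of the
  one-dimensional integrals; one of them vanishes as soon as some entry of \<open>z\<close> is nonzero.
\<close>

lemma integral_character_unit_cube:
  fixes z :: "real^'n"
  assumes "\<forall>i. z $ i \<in> \<int>"
  shows "(LINT u:{u. \<forall>i. 0 \<le> u $ i \<and> u $ i < 1}|lborel. lattice_char u z) = (if z = 0 then 1 else 0)"
proof -
  interpret product_sigma_finite "\<lambda>_::'n. lborel :: real measure"
    by standard
  note [measurable] = borel_measurable_vec_lambda_PiM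
  let ?C = "{u::real^'n. \<forall>i. 0 \<le> u $ i \<and> u $ i < 1}"
  let ?e = "\<lambda>i u. indicator {0..<1} u *\<^sub>R exp (- 2 * of_real pi * \<i> * of_real (z $ i * u)) :: complex"
  have [measurable]: "?C \<in> sets borel"
    by measurable
  have prod: "indicator ?C (\<chi> i. u i) *\<^sub>R lattice_char (\<chi> i. u i) z = (\<Prod>i\<in>UNIV. ?e i (u i))" for u
  proof (cases "(\<chi> i. u i) \<in> ?C")
    case True
    then have "(\<Prod>i\<in>UNIV. ?e i (u i)) = (\<Prod>i\<in>UNIV. exp (- 2 * of_real pi * \<i> * of_real (z $ i * u i)))"
      by (intro prod.cong) auto
    also have "\<dots> = lattice_char (\<chi> i. u i) z"
      by (simp add: lattice_char_def inner_vec_def exp_sum[symmetric] sum_distrib_left mult.assoc)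
    finally show ?thesis
      using True by simp
  next
    case False
    then obtain i where "\<not> (0 \<le> u i \<and> u i < 1)"
      by auto
    then have "?e i (u i) = 0"
      by auto
    then have "(\<Prod>i\<in>UNIV. ?e i (u i)) = 0"
      by (meson UNIV_I finite prod_zero)
    then show ?thesis
      using False by simp
  qed
  have "(LINT u:?C|lborel. lattice_char u z)
      = (LINT u|(\<Pi>\<^sub>M i\<in>UNIV. lborel). indicator ?C (\<chi> i. u i) *\<^sub>R lattice_char (\<chi> i. u i) z)"
    unfolding set_lebesgue_integral_def by (subst lborel_cart) (simp add: integral_distr)
  also have "\<dots> = (\<Prod>i\<in>UNIV. integral\<^sup>L lborel (?e i))"
    unfolding prod using has_bochner_integral_character_Ico assms
    by (intro product_integral_prod) (auto simp: has_bochner_integral_iff)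
  also have "\<dots> = (\<Prod>i\<in>UNIV. if z $ i = 0 then 1 else 0)"
    using has_bochner_integral_character_Ico assms
    by (intro prod.cong) (auto simp: has_bochner_integral_iff)
  also have "\<dots> = (if z = 0 then 1 else 0)"
    by (auto simp: vec_eq_iff)
  finally show ?thesis .
qed

lemma transpose_matrix_inv_cancel:
  fixes A :: "real^'n^'n"
  assumes "invertible A"
  shows "transpose A ** transpose (matrix_inv A) = mat 1"
    and "transpose (matrix_inv A) ** transpose A = mat 1"
proof -
  have "A ** matrix_inv A = mat 1 \<and> matrix_inv A ** A = mat 1"
    using assms unfolding invertible_def matrix_inv_def by (rule someI_ex)
  then show "transpose A ** transpose (matrix_inv A) = mat 1"
    and "transpose (matrix_inv A) ** transpose A = mat 1"
    by (simp_all flip: matrix_transpose_mul)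
qed

text \<open>
  The description by inequalities, rather than as an image, makes measurability evident.
\<close>

lemma BZ_eq:
  fixes A :: "real^'n^'n"
  assumes "invertible A"
  shows "BZ A = {p. \<forall>i. 0 \<le> (transpose A *v p) $ i \<and> (transpose A *v p) $ i < 1}"
proof safe
  fix p i assume "p \<in> BZ A"
  then show "0 \<le> (transpose A *v p) $ i" "(transpose A *v p) $ i < 1"
    by (auto simp: BZ_def matrix_vector_mul_assoc transpose_matrix_inv_cancel[OF assms]
        simp del: transpose_matrix_vector)
next
  fix p assume "\<forall>i. 0 \<le> (transpose A *v p) $ i \<and> (transpose A *v p) $ i < 1"
  moreover have "p = transpose (matrix_inv A) *v (transpose A *v p)"
    by (simp add: matrix_vector_mul_assoc transpose_matrix_inv_cancel[OF assms]
        del: transpose_matrix_vector)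
  ultimately show "p \<in> BZ A"
    unfolding BZ_def by blast
qed

lemma BZ_borel [measurable]:
  fixes A :: "real^'n^'n"
  assumes "invertible A"
  shows "BZ A \<in> sets borel"
proof -
  have [measurable]: "(\<lambda>p. transpose A *v p) \<in> borel_measurable borel"
    by (intro borel_measurable_linear_cart matrix_vector_mul_linear)
  show ?thesis
    unfolding BZ_eq[OF assms] by measurable
qed

lemma lborel_eq_transpose_inv:
  fixes A :: "real^'n^'n"
  assumes "invertible A"
  shows "lborel = density (distr lborel borel (\<lambda>u. transpose (matrix_inv A) *v u)) (\<lambda>_. ennreal (1 / cell_volume A))"
proof -
  let ?B = "transpose (matrix_inv A)"
  have "det (transpose A) * det ?B = 1"
    by (simp only: det_mul[symmetric] transpose_matrix_inv_cancel(1)[OF assms] det_I)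
  then have det: "det A * det ?B = 1"
    by (simp add: det_transpose)
  then have "\<bar>det A\<bar> * \<bar>det ?B\<bar> = 1"
    by (simp flip: abs_mult)
  then have "\<bar>det ?B\<bar> = 1 / cell_volume A"
    unfolding cell_volume_def by (subst nonzero_eq_divide_eq) (auto simp: mult.commute)
  moreover have "det (matrix (\<lambda>u. ?B *v u)) \<noteq> 0"
    using det by (auto simp del: transpose_matrix_vector)
  then have "lborel = density (distr lborel borel (\<lambda>u. ?B *v u)) (\<lambda>_. ennreal \<bar>det (matrix (\<lambda>u. ?B *v u))\<bar>)"
    by (intro lborel_distr_linear matrix_vector_mul_linear)
  ultimately show ?thesis
    by (simp only: matrix_of_matrix_vector_mul)
qed

lemma emeasure_BZ_finite:
  fixes A :: "real^'n^'n"
  assumes "invertible A"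
  shows "emeasure lborel (BZ A) < \<infinity>"
proof -
  let ?C = "{u::real^'n. \<forall>i. 0 \<le> u $ i \<and> u $ i < 1}"
  have "?C \<subseteq> cbox 0 (\<chi> i. 1)"
    by (auto simp: mem_box_cart less_imp_le)
  then have "bounded ?C"
    by (rule bounded_subset[OF bounded_cbox])
  then have "bounded ((\<lambda>u. transpose (matrix_inv A) *v u) ` ?C)"
    by (rule bounded_linear_image) (rule matrix_vector_mul_bounded_linear)
  also have "(\<lambda>u. transpose (matrix_inv A) *v u) ` ?C = BZ A"
    unfolding BZ_def by blast
  finally have "bounded (BZ A)" .
  then show ?thesis
    by (rule emeasure_bounded_finite)
qed

text \<open>
  Under the substitution \<open>p = A\<^sup>-\<^sup>T u\<close> the zone becomes the unit cube and \<open>(A z) \<bullet> p\<close> becomes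
  \<open>z \<bullet> u\<close>; the Jacobian cancels the cell volume.
\<close>

proposition BZ_character_orthogonality:
  fixes A :: "real^'n^'n"
  assumes "invertible A" and "x \<in> lattice A"
  shows "of_real (cell_volume A) * (LINT p:BZ A|lborel. lattice_char p x) = (if x = 0 then 1 else 0)"
proof -
  let ?B = "transpose (matrix_inv A)"
  let ?C = "{u::real^'n. \<forall>i. 0 \<le> u $ i \<and> u $ i < 1}"
  obtain z where z: "x = A *v z" "\<forall>i. z $ i \<in> \<int>"
    using assms(2) by (auto simp: lattice_def)
  have [measurable]: "(\<lambda>p. ?B *v p) \<in> borel_measurable borel"
    by (intro borel_measurable_linear_cart matrix_vector_mul_linear)
  note [measurable] = BZ_borel[OF assms(1)]
  have V: "cell_volume A > 0"
    using assms(1) by (simp add: cell_volume_def invertible_det_nz)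
  have ind: "indicator (BZ A) (?B *v u) = (indicator ?C u :: real)" for u
    by (auto simp: BZ_eq[OF assms(1)] indicator_def matrix_vector_mul_assoc
        transpose_matrix_inv_cancel[OF assms(1)] simp del: transpose_matrix_vector)
  have "x \<bullet> (?B *v u) = z \<bullet> u" for u
  proof -
    have "x \<bullet> (?B *v u) = (z v* transpose A) \<bullet> (?B *v u)"
      using z(1) by simp
    also have "\<dots> = z \<bullet> u"
      by (simp only: dot_lmul_matrix matrix_vector_mul_assoc transpose_matrix_inv_cancel[OF assms(1)]
          matrix_vector_mul_lid)
    finally show ?thesis .
  qed
  then have char: "lattice_char (?B *v u) x = lattice_char u z" for u
    by (simp add: lattice_char_def)
  have "(LINT p:BZ A|lborel. lattice_char p x) =
      (1 / cell_volume A) *\<^sub>R (LINT u:?C|lborel. lattice_char u z)"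
    unfolding set_lebesgue_integral_def
    by (subst lborel_eq_transpose_inv[OF assms(1)])
      (use V in \<open>simp add: integral_density integral_distr ind char
        del: transpose_matrix_vector scaleR_scaleR\<close>)
  also have "\<dots> = (1 / cell_volume A) *\<^sub>R (if z = 0 then 1 else 0)"
    using integral_character_unit_cube[OF z(2)] by simp
  also have "z = 0 \<longleftrightarrow> x = 0"
    using inj_eq[OF invertible_imp_inj[OF assms(1)], of z 0] z(1) by simp
  finally show ?thesis
    using V by (auto simp: scaleR_conv_of_real)
qed

section \<open>Convolution of lattice Fourier series\<close>

lemma set_integrable_bounded_continuous:
  fixes g :: "'b::euclidean_space \<Rightarrow> 'c::{banach,second_countable_topology}"
  assumes "S \<in> sets borel" "emeasure lborel S < \<infinity>"
    and "continuous_on UNIV g" and "\<And>p. norm (g p) \<le> C"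
  shows "set_integrable lborel S g"
  unfolding set_integrable_def using assms
  by (intro integrableI_bounded_set_indicator[where B = C]) (auto intro: borel_measurable_continuous_onI)

text \<open>
  By the majorant \<open>M\<close> the partial sums converge uniformly, so on a set of finite measure their
  integrals converge.  Uniform convergence also makes the limit continuous, hence measurable, whatever
  the cardinality of the index set.
\<close>

lemma has_sum_set_integral:
  fixes f :: "'a \<Rightarrow> 'b::euclidean_space \<Rightarrow> complex"
  assumes S: "S \<in> sets borel" "emeasure lborel S < \<infinity>"
    and cont: "\<And>x. x \<in> X \<Longrightarrow> continuous_on UNIV (f x)"
    and bound: "\<And>x p. x \<in> X \<Longrightarrow> norm (f x p) \<le> M x"
    and M: "M summable_on X"
  shows "((\<lambda>x. LINT p:S|lborel. f x p) has_sum (LINT p:S|lborel. \<Sum>\<^sub>\<infinity>x\<in>X. f x p)) X"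
proof -
  define F where "F p = (\<Sum>\<^sub>\<infinity>x\<in>X. f x p)" for p
  have ul: "uniform_limit UNIV (\<lambda>Y p. \<Sum>x\<in>Y. f x p) F (finite_subsets_at_top X)"
    unfolding F_def using bound M by (intro Weierstrass_m_test_general) auto
  have contF: "continuous_on UNIV F"
    using ul
    by (rule uniform_limit_theorem[rotated])
      (auto intro!: eventually_finite_subsets_at_top_weakI continuous_on_sum cont)
  have boundF: "norm (F p) \<le> infsum M X" for p
  proof -
    have "(\<lambda>x. norm (f x p)) summable_on X"
      using bound by (intro summable_on_comparison_test[OF M]) auto
    then show ?thesis
      unfolding F_def using bound
      by (intro norm_infsum_le[OF has_sum_infsum[OF abs_summable_summable] has_sum_infsum[OF M]])
  qed
  have intF: "set_integrable lborel S F"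
    by (rule set_integrable_bounded_continuous[OF S contF boundF])
  have intf: "set_integrable lborel S (f x)" if "x \<in> X" for x
    by (rule set_integrable_bounded_continuous[OF S cont bound]) (use that in auto)
  have "((\<lambda>Y. \<Sum>x\<in>Y. LINT p:S|lborel. f x p) \<longlongrightarrow> (LINT p:S|lborel. F p)) (finite_subsets_at_top X)"
  proof (rule tendstoI)
    fix e :: real assume "e > 0"
    define m where "m = measure lborel S"
    have m: "m \<ge> 0"
      by (simp add: m_def)
    \<comment> \<open>The summand one keeps the quotient meaningful when \<open>S\<close> is a null set.\<close>
    define d where "d = e / (m + 1)"
    have d: "d > 0" "d * m < e"
      using m \<open>e > 0\<close> by (auto simp: d_def field_simps)
    have "\<forall>\<^sub>F Y in finite_subsets_at_top X. finite Y \<and> Y \<subseteq> X"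
      by (auto intro: eventually_finite_subsets_at_top_weakI)
    with uniform_limitD[OF ul d(1)]
    show "\<forall>\<^sub>F Y in finite_subsets_at_top X.
        dist (\<Sum>x\<in>Y. LINT p:S|lborel. f x p) (LINT p:S|lborel. F p) < e"
    proof eventually_elim
      case (elim Y)
      then have Y: "finite Y" "Y \<subseteq> X"
        by auto
      have intY: "set_integrable lborel S (\<lambda>p. \<Sum>x\<in>Y. f x p)"
        using intf Y unfolding set_integrable_def
        by (subst scaleR_sum_right) (intro Bochner_Integration.integrable_sum, auto)
      have "(\<Sum>x\<in>Y. LINT p:S|lborel. f x p) = (LINT p:S|lborel. \<Sum>x\<in>Y. f x p)"
        using intf Y unfolding set_integrable_def set_lebesgue_integral_def
        by (subst Bochner_Integration.integral_sum[symmetric]) (auto simp: scaleR_sum_right)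
      then have "(\<Sum>x\<in>Y. LINT p:S|lborel. f x p) - (LINT p:S|lborel. F p)
          = (LINT p:S|lborel. (\<Sum>x\<in>Y. f x p) - F p)"
        using intY intF by (simp add: set_integral_diff)
      also have "norm \<dots> \<le> (LINT p:S|lborel. norm ((\<Sum>x\<in>Y. f x p) - F p))"
        using integral_norm_bound[of lborel "\<lambda>p. indicator S p *\<^sub>R ((\<Sum>x\<in>Y. f x p) - F p)"]
        by (simp add: set_lebesgue_integral_def)
      also have "\<dots> \<le> (LINT p:S|lborel. d)"
      proof (rule set_integral_mono)
        show "set_integrable lborel S (\<lambda>p. norm ((\<Sum>x\<in>Y. f x p) - F p))"
          using set_integrable_norm[OF set_integral_diff(1)[OF intY intF]] .
        show "set_integrable lborel S (\<lambda>p. d)"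
          using S by (simp add: set_integrable_def)
        show "norm ((\<Sum>x\<in>Y. f x p) - F p) \<le> d" for p
          using elim by (auto simp: dist_norm less_imp_le)
      qed
      also have "\<dots> = m * d"
        using S by (simp add: set_lebesgue_integral_def m_def)
      also have "\<dots> < e"
        using d(2) by (simp add: mult.commute)
      finally show ?case
        by (simp add: dist_norm)
    qed
  qed
  then show ?thesis
    by (simp add: has_sum_def F_def)
qed

text \<open>
  Write the product of the two series as one series over pairs \<open>(x, y)\<close> and integrate term by term.
  The integral of the term for \<open>(x, y)\<close> contains the character of \<open>y - x\<close>, so by orthogonality only the
  diagonal survives.
\<close>

theorem BZ_convolution_lattice_fourier:
  fixes A :: "real^'n^'n"
  assumes "invertible A" and K: "l1_kernel A K" and L: "l1_kernel A L"
  shows "BZ_convolution A (lattice_fourier A K) (lattice_fourier A L) k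
       = lattice_fourier A (\<lambda>x. K x * L x) k"
proof -
  define \<Lambda> where "\<Lambda> = lattice A"
  define V where "V = (of_real (cell_volume A) :: complex)"
  define f where "f = (\<lambda>(x, y) p. K x * L y * (lattice_char (k - p) x * lattice_char p y))"
  have sK: "(\<lambda>x. norm (K x)) summable_on \<Lambda>" and sL: "(\<lambda>x. norm (L x)) summable_on \<Lambda>"
    using K L by (auto simp: l1_kernel_def \<Lambda>_def)
  have M: "(\<lambda>(x, y). norm (K x) * norm (L y)) summable_on \<Lambda> \<times> \<Lambda>"
    using sK sL
    by (intro summable_on_SigmaI[where g = "\<lambda>x. norm (K x) * infsum (\<lambda>y. norm (L y)) \<Lambda>"])
      (auto intro!: has_sum_cmult_right has_sum_infsum summable_on_cmult_left)
  have nf: "norm (f xy p) = (\<lambda>(x, y). norm (K x) * norm (L y)) xy" for xy p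
    by (auto simp: f_def norm_mult split: prod.splits)
  have cont: "continuous_on UNIV (f xy)" for xy
    unfolding f_def lattice_char_def by (auto simp: case_prod_beta intro!: continuous_intros)
  have prod: "lattice_fourier A K (k - p) * lattice_fourier A L p = (\<Sum>\<^sub>\<infinity>xy\<in>\<Lambda>\<times>\<Lambda>. f xy p)" for p
  proof -
    have "(\<lambda>xy. norm (f xy p)) summable_on \<Lambda> \<times> \<Lambda>"
      using M by (simp add: nf)
    then have s: "(\<lambda>xy. f xy p) summable_on \<Lambda> \<times> \<Lambda>"
      by (rule abs_summable_summable)
    have "(\<Sum>\<^sub>\<infinity>xy\<in>\<Lambda>\<times>\<Lambda>. f xy p) = (\<Sum>\<^sub>\<infinity>x\<in>\<Lambda>. \<Sum>\<^sub>\<infinity>y\<in>\<Lambda>. f (x, y) p)"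
      using infsum_Sigma'_banach[of "\<lambda>x y. f (x, y) p" \<Lambda> "\<lambda>_. \<Lambda>"] s by (simp add: cond_case_prod_eta)
    also have "\<dots> = (\<Sum>\<^sub>\<infinity>x\<in>\<Lambda>. K x * lattice_char (k - p) x * (\<Sum>\<^sub>\<infinity>y\<in>\<Lambda>. L y * lattice_char p y))"
      unfolding infsum_cmult_right'[symmetric] by (simp add: f_def mult_ac)
    also have "\<dots> = lattice_fourier A K (k - p) * lattice_fourier A L p"
      by (simp add: lattice_fourier_def \<Lambda>_def infsum_cmult_left')
    finally show ?thesis
      by simp
  qed
  define g where "g xy = V * (LINT p:BZ A|lborel. f xy p)" for xy
  have g: "g (x, y) = (if y = x then K x * L x * lattice_char k x else 0)"
    if "x \<in> \<Lambda>" "y \<in> \<Lambda>" for x y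
  proof -
    have "f (x, y) p = K x * L y * lattice_char k x * lattice_char p (y - x)" for p
      using lattice_char_add_left[of k "- p" x] by (simp add: f_def lattice_char_diff_right)
    then have "V * (LINT p:BZ A|lborel. f (x, y) p)
        = K x * L y * lattice_char k x * (V * (LINT p:BZ A|lborel. lattice_char p (y - x)))"
      by simp
    then show ?thesis
      using BZ_character_orthogonality[OF assms(1), of "y - x"] that lattice_diff[of y A x]
      by (auto simp: g_def V_def \<Lambda>_def)
  qed
  have "(g has_sum
      V * (LINT p:BZ A|lborel. \<Sum>\<^sub>\<infinity>xy\<in>\<Lambda>\<times>\<Lambda>. f xy p)) (\<Lambda> \<times> \<Lambda>)"
    using nf M BZ_borel[OF assms(1)] emeasure_BZ_finite[OF assms(1)] cont
    unfolding g_def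
    by (intro has_sum_cmult_right has_sum_set_integral[where M = "\<lambda>(x, y). norm (K x) * norm (L y)"]) auto
  also have "V * (LINT p:BZ A|lborel. \<Sum>\<^sub>\<infinity>xy\<in>\<Lambda>\<times>\<Lambda>. f xy p)
      = BZ_convolution A (lattice_fourier A K) (lattice_fourier A L) k"
    by (simp add: BZ_convolution_def V_def prod)
  finally have "(g has_sum
      BZ_convolution A (lattice_fourier A K) (lattice_fourier A L) k) (\<Lambda> \<times> \<Lambda>)" .
  also have "?this \<longleftrightarrow> ((\<lambda>xy. K (fst xy) * L (fst xy) * lattice_char k (fst xy)) has_sum
      BZ_convolution A (lattice_fourier A K) (lattice_fourier A L) k) ((\<lambda>x. (x, x)) ` \<Lambda>)"
    by (rule has_sum_cong_neutral) (auto simp: g image_iff)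
  also have "\<dots> \<longleftrightarrow> ((\<lambda>x. K x * L x * lattice_char k x) has_sum
      BZ_convolution A (lattice_fourier A K) (lattice_fourier A L) k) \<Lambda>"
    by (subst has_sum_reindex) (auto simp: inj_on_def o_def)
  finally show ?thesis
    by (simp add: lattice_fourier_def \<Lambda>_def infsumI)
qed

section \<open>Summability of power-law kernels\<close>

lemma summable_on_Ints_powr:
  fixes \<sigma> :: real
  assumes "\<sigma> > 1"
  shows "(\<lambda>u::real. (1 + \<bar>u\<bar>) powr (- \<sigma>)) summable_on \<int>"
proof -
  have "summable (\<lambda>n. real n powr (- \<sigma>))"
    using assms by (simp add: summable_real_powr_iff)
  then have "summable (\<lambda>n. real (Suc n) powr (- \<sigma>))"
    by (subst summable_Suc_iff)
  then have nat: "(\<lambda>n. (1 + real n) powr (- \<sigma>)) summable_on UNIV"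
    by (subst summable_on_UNIV_nonneg_real_iff) (auto simp: add.commute)
  have pos: "(\<lambda>u::real. (1 + \<bar>u\<bar>) powr (- \<sigma>)) summable_on range real"
    using nat by (subst summable_on_reindex) (auto simp: o_def inj_on_def)
  have neg: "(\<lambda>u::real. (1 + \<bar>u\<bar>) powr (- \<sigma>)) summable_on range (\<lambda>n. - real n)"
    using nat by (subst summable_on_reindex) (auto simp: o_def inj_on_def)
  have "(\<int>::real set) = range real \<union> (range (\<lambda>n. - real n) - range real)"
  proof safe
    fix u :: real assume u: "u \<in> \<int>" "u \<notin> range real"
    then obtain m where "u = of_int m"
      by (auto elim: Ints_cases)
    with u(2) show "u \<in> range (\<lambda>n. - real n)"
      by (cases m rule: int_cases2) auto
  qed auto
  moreover have "(\<lambda>u::real. (1 + \<bar>u\<bar>) powr (- \<sigma>)) summable_on range (\<lambda>n. - real n) - range real"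
    using neg by (rule summable_on_subset_banach) auto
  ultimately show ?thesis
    using summable_on_Un_disjoint[OF pos] by (metis Diff_disjoint)
qed

text \<open>
  Let \<open>d\<close> be the dimension and \<open>\<sigma> = s / d > 1\<close>.  For a nonzero integer vector every factor of \<open>\<Prod>i. (1 + \<bar>z $ i\<bar>)\<close> is at most a
  constant times the norm of \<open>A z\<close>, so the \<open>s\<close>-th inverse power of that norm is dominated by
  \<open>\<Prod>i. (1 + \<bar>z $ i\<bar>) powr (- \<sigma>)\<close>, whose sum over all \<open>z\<close> is the \<open>d\<close>-th power of a convergent
  one-dimensional sum.  The origin contributes nothing since \<open>0 powr (- s) = 0\<close>.
\<close>

lemma lattice_powr_summable:
  fixes A :: "real^'n^'n"
  assumes "invertible A" and s: "s > real CARD('n)"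
  shows "(\<lambda>x. norm x powr (- s)) summable_on lattice A"
proof -
  define \<sigma> where "\<sigma> = s / real CARD('n)"
  have \<sigma>: "\<sigma> > 1" "\<sigma> * real CARD('n) = s"
    using s by (auto simp: \<sigma>_def field_simps)
  define h where "h u = (1 + \<bar>u\<bar>) powr (- \<sigma>)" for u :: real
  define I where "I = (\<Pi>\<^sub>E i\<in>(UNIV::'n set). (\<int>::real set))"
  have h: "h summable_on \<int>"
    unfolding h_def using \<sigma>(1) by (rule summable_on_Ints_powr)
  have h_pos: "h u > 0" for u
    by (simp add: h_def add_pos_nonneg)
  \<comment> \<open>Summability of the product family is inferred from its sum being nonzero: an infinite sum that does
    not exist has the value zero.\<close>
  have "infsum h \<int> \<ge> infsum h {0}"
    using h h_pos by (intro infsum_mono_neutral) (auto intro: less_imp_le)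
  then have "infsum h \<int> > 0"
    using h_pos[of 0] by simp
  moreover have "infsum (\<lambda>g. \<Prod>i\<in>(UNIV::'n set). h (g i)) I = (\<Prod>i\<in>(UNIV::'n set). infsum h \<int>)"
    unfolding I_def using h h_pos by (intro infsum_prod_PiE_abs) (auto simp: less_imp_le)
  ultimately have "infsum (\<lambda>g. \<Prod>i\<in>(UNIV::'n set). h (g i)) I \<noteq> 0"
    by simp
  then have prod: "(\<lambda>g. \<Prod>i\<in>(UNIV::'n set). h (g i)) summable_on I"
    using infsum_not_exists by blast
  obtain c where c: "c > 0" and
    below: "\<And>z. \<forall>i. z $ i \<in> \<int> \<Longrightarrow> z \<noteq> 0 \<Longrightarrow> 1 \<le> norm z \<and> c * norm z \<le> norm (A *v z)"
    using lattice_norm_bounded_below[OF assms(1)] by blast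
  let ?\<phi> = "\<lambda>g. A *v (\<chi> i. g i)"
  have bound: "norm (?\<phi> g) powr (- s) \<le> (2 / c) powr s * (\<Prod>i\<in>(UNIV::'n set). h (g i))" if "g \<in> I" for g
  proof (cases "(\<chi> i. g i) = (0::real^'n)")
    case True
    then show ?thesis
      using h_pos by (simp add: prod_nonneg less_imp_le)
  next
    case False
    let ?z = "(\<chi> i. g i) :: real^'n"
    let ?r = "2 / c * norm (A *v ?z)"
    have z: "1 \<le> norm ?z" "c * norm ?z \<le> norm (A *v ?z)"
      using below[of ?z] False that by (auto simp: I_def)
    then have "c \<le> norm (A *v ?z)"
      using c by (smt (verit) mult_left_mono mult_cancel_left2)
    then have pos: "norm (A *v ?z) > 0"
      using c by linarith
    have "?r powr (- \<sigma>) \<le> h (g i)" for i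
    proof -
      have "1 + \<bar>g i\<bar> \<le> 2 * norm ?z"
        using z(1) component_le_norm_cart[of ?z i] by simp
      also have "\<dots> \<le> ?r"
        using z(2) c by (simp add: field_simps)
      finally show ?thesis
        unfolding h_def using \<sigma>(1) by (intro powr_mono2') auto
    qed
    then have "(\<Prod>i\<in>(UNIV::'n set). ?r powr (- \<sigma>)) \<le> (\<Prod>i\<in>UNIV. h (g i))"
      by (intro prod_mono) auto
    also have "(\<Prod>i\<in>(UNIV::'n set). ?r powr (- \<sigma>)) = ?r powr (- s)"
      using pos c by (simp add: powr_powr \<sigma>(2) flip: powr_realpow)
    also have "\<dots> = norm (A *v ?z) powr (- s) / (2 / c) powr s"
      using c pos by (simp add: powr_mult powr_divide powr_minus_divide)
    finally show ?thesis
      using c by (simp add: field_simps)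
  qed
  have "(\<lambda>g. norm (?\<phi> g) powr (- s)) summable_on I"
    by (rule summable_on_comparison_test[OF summable_on_cmult_right[OF prod, of "(2 / c) powr s"]])
      (use bound in auto)
  moreover have "bij_betw ?\<phi> I (lattice A)"
  proof (rule bij_betwI')
    fix g g' :: "'n \<Rightarrow> real"
    have "inj ((*v) A)"
      using assms(1) by (rule invertible_imp_inj)
    then show "(?\<phi> g = ?\<phi> g') = (g = g')"
      by (simp add: inj_eq)
  next
    fix g assume "g \<in> I"
    then show "?\<phi> g \<in> lattice A"
      by (auto simp: I_def lattice_def PiE_UNIV_domain Pi_iff intro!: exI[of _ "\<chi> i. g i"])
  next
    fix x assume "x \<in> lattice A"
    then obtain z where "x = A *v z" "\<forall>i. z $ i \<in> \<int>"
      by (auto simp: lattice_def)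
    then show "\<exists>g\<in>I. x = ?\<phi> g"
      by (intro bexI[of _ "\<lambda>i. z $ i"]) (auto simp: I_def)
  qed
  ultimately show ?thesis
    using summable_on_reindex_bij_betw[of ?\<phi> I "lattice A" "\<lambda>x. norm x powr (- s)"] by simp
qed

lemma norm_power_kernel: "norm (power_kernel \<nu> x) = norm x powr (- Re \<nu>)"
  by (auto simp: power_kernel_def norm_powr_real_powr)

lemma power_kernel_mult: "power_kernel \<nu> x * power_kernel \<mu> x = power_kernel (\<nu> + \<mu>) x"
  by (simp add: power_kernel_def powr_add[symmetric])

lemma power_kernel_minus: "power_kernel \<nu> (- x) = power_kernel \<nu> x"
  by (simp add: power_kernel_def)

lemma l1_kernel_power_kernel:
  fixes A :: "real^'n^'n"
  assumes "invertible A" and "Re \<nu> > real CARD('n)"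
  shows "l1_kernel A (power_kernel \<nu>)"
  using lattice_powr_summable[OF assms] by (simp add: l1_kernel_def norm_power_kernel)

section \<open>Decay rates on the lattice\<close>

definition lattice_decay :: "real^'n^'n \<Rightarrow> real \<Rightarrow> (real^'n \<Rightarrow> complex) \<Rightarrow> bool" where
  "lattice_decay A \<gamma> f \<longleftrightarrow> (\<exists>C. \<forall>x\<in>lattice A - {0}. norm (f x) \<le> C * norm x powr (- \<gamma>))"

lemma lattice_decayI:
  "(\<And>x. x \<in> lattice A - {0} \<Longrightarrow> norm (f x) \<le> C * norm x powr (- \<gamma>)) \<Longrightarrow> lattice_decay A \<gamma> f"
  unfolding lattice_decay_def by blast

lemma lattice_decayE:
  assumes "lattice_decay A \<gamma> f"
  obtains C where "C > 0" and "\<And>x. x \<in> lattice A - {0} \<Longrightarrow> norm (f x) \<le> C * norm x powr (- \<gamma>)"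
proof -
  obtain C where C: "\<And>x. x \<in> lattice A - {0} \<Longrightarrow> norm (f x) \<le> C * norm x powr (- \<gamma>)"
    using assms by (auto simp: lattice_decay_def)
  have "norm (f x) \<le> (\<bar>C\<bar> + 1) * norm x powr (- \<gamma>)" if "x \<in> lattice A - {0}" for x
    by (rule order_trans[OF C[OF that]]) (intro mult_right_mono, auto)
  then show ?thesis
    using that[of "\<bar>C\<bar> + 1"] by auto
qed

lemma lattice_decay_add:
  assumes "lattice_decay A \<gamma> f" "lattice_decay A \<gamma> g"
  shows "lattice_decay A \<gamma> (\<lambda>x. f x + g x)"
proof -
  obtain C D where "\<And>x. x \<in> lattice A - {0} \<Longrightarrow> norm (f x) \<le> C * norm x powr (- \<gamma>)"
    "\<And>x. x \<in> lattice A - {0} \<Longrightarrow> norm (g x) \<le> D * norm x powr (- \<gamma>)"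
    using assms by (auto simp: lattice_decay_def)
  then show ?thesis
    by (intro lattice_decayI[where C = "C + D"]) (auto simp: ring_distribs intro!: norm_triangle_le add_mono)
qed

lemma lattice_decay_sum:
  assumes "\<And>j. j \<in> J \<Longrightarrow> lattice_decay A \<gamma> (f j)"
  shows "lattice_decay A \<gamma> (\<lambda>x. \<Sum>j\<in>J. f j x)"
proof (cases "finite J")
  case True
  then show ?thesis
    using assms
    by (induction J) (auto intro: lattice_decay_add lattice_decayI[where C = 0])
qed (auto intro: lattice_decayI[where C = 0])

lemma lattice_decay_mult:
  assumes "lattice_decay A \<gamma> f" "lattice_decay A \<delta> g"
  shows "lattice_decay A (\<gamma> + \<delta>) (\<lambda>x. f x * g x)"
proof -
  obtain C where C: "\<And>x. x \<in> lattice A - {0} \<Longrightarrow> norm (f x) \<le> C * norm x powr (- \<gamma>)" "C > 0"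
    using assms(1) by (elim lattice_decayE) auto
  obtain D where D: "\<And>x. x \<in> lattice A - {0} \<Longrightarrow> norm (g x) \<le> D * norm x powr (- \<delta>)"
    using assms(2) by (elim lattice_decayE) auto
  show ?thesis
  proof (rule lattice_decayI)
    fix x assume x: "x \<in> lattice A - {0}"
    have "norm (f x * g x) \<le> (C * norm x powr (- \<gamma>)) * (D * norm x powr (- \<delta>))"
      unfolding norm_mult using C D x by (intro mult_mono) auto
    also have "\<dots> = (C * D) * norm x powr (- (\<gamma> + \<delta>))"
      by (simp only: minus_add_distrib powr_add mult_ac)
    finally show "norm (f x * g x) \<le> (C * D) * norm x powr (- (\<gamma> + \<delta>))" .
  qed
qed

text \<open>
  Lowering the rate costs a constant factor, because the norm is bounded below on the nonzero lattice
  vectors.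
\<close>

lemma lattice_decay_mono:
  fixes A :: "real^'n^'n"
  assumes "invertible A" and "lattice_decay A \<gamma> f" and "\<delta> \<le> \<gamma>"
  shows "lattice_decay A \<delta> f"
proof -
  obtain c where c: "c > 0" and
    below: "\<And>z. \<forall>i. z $ i \<in> \<int> \<Longrightarrow> z \<noteq> 0 \<Longrightarrow> 1 \<le> norm z \<and> c * norm z \<le> norm (A *v z)"
    using lattice_norm_bounded_below[OF assms(1)] by blast
  obtain C where C: "C > 0" "\<And>x. x \<in> lattice A - {0} \<Longrightarrow> norm (f x) \<le> C * norm x powr (- \<gamma>)"
    using assms(2) by (elim lattice_decayE) auto
  show ?thesis
  proof (rule lattice_decayI)
    fix x assume x: "x \<in> lattice A - {0}"
    then obtain z where z: "x = A *v z" "\<forall>i. z $ i \<in> \<int>"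
      by (auto simp: lattice_def)
    then have z0: "z \<noteq> 0"
      using x by auto
    have "c * 1 \<le> c * norm z"
      using below[OF z(2) z0] c by (intro mult_left_mono) auto
    moreover have "c * norm z \<le> norm x"
      using below[OF z(2) z0] z(1) by simp
    ultimately have cx: "c \<le> norm x"
      by linarith
    have "norm (f x) \<le> C * norm x powr (- \<gamma>)"
      using C(2) x by blast
    also have "norm x powr (- \<gamma>) = norm x powr (- (\<gamma> - \<delta>)) * norm x powr (- \<delta>)"
      by (simp add: powr_add[symmetric])
    also have "C * \<dots> \<le> C * (c powr (- (\<gamma> - \<delta>)) * norm x powr (- \<delta>))"
      using C(1) c cx assms(3) by (intro mult_left_mono mult_right_mono powr_mono2') auto
    finally show "norm (f x) \<le> (C * c powr (- (\<gamma> - \<delta>))) * norm x powr (- \<delta>)"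
      by (simp add: mult_ac)
  qed
qed

lemma lattice_decay_power_kernel: "lattice_decay A (Re \<nu>) (\<lambda>x. b * power_kernel \<nu> x)"
  by (rule lattice_decayI[where C = "norm b"]) (simp add: norm_mult norm_power_kernel)

section \<open>Absolutely summable kernels\<close>

text \<open>
  Each value of a summable kernel is bounded by its total sum, so one factor is summable and the other
  bounded.
\<close>

lemma l1_kernel_mult:
  assumes "l1_kernel A K" "l1_kernel A L"
  shows "l1_kernel A (\<lambda>x. K x * L x)"
proof -
  have K: "(\<lambda>x. norm (K x)) summable_on lattice A" and L: "(\<lambda>x. norm (L x)) summable_on lattice A"
    using assms by (auto simp: l1_kernel_def)
  have "norm (K x * L x) \<le> norm (K x) * infsum (\<lambda>x. norm (L x)) (lattice A)" if "x \<in> lattice A" for x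
  proof -
    have "infsum (\<lambda>x. norm (L x)) {x} \<le> infsum (\<lambda>x. norm (L x)) (lattice A)"
      using L that by (intro infsum_mono_neutral) auto
    then show ?thesis
      by (simp add: norm_mult mult_left_mono)
  qed
  then show ?thesis
    unfolding l1_kernel_def
    by (intro summable_on_comparison_test[OF summable_on_cmult_left[OF K]]) auto
qed

lemma l1_kernel_fourier_has_sum:
  assumes "l1_kernel A K"
  shows "((\<lambda>x. K x * lattice_char k x) has_sum lattice_fourier A K k) (lattice A)"
proof -
  have "(\<lambda>x. norm (K x * lattice_char k x)) summable_on lattice A"
    using assms by (simp add: l1_kernel_def norm_mult)
  then show ?thesis
    unfolding lattice_fourier_def by (rule has_sum_infsum[OF abs_summable_summable])
qed

lemma has_sum_finite_sum:
  fixes f :: "'i \<Rightarrow> 'a \<Rightarrow> 'b::topological_comm_monoid_add"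
  assumes "\<And>i. i \<in> I \<Longrightarrow> (f i has_sum s i) X"
  shows "((\<lambda>x. \<Sum>i\<in>I. f i x) has_sum (\<Sum>i\<in>I. s i)) X"
  using assms by (induction I rule: infinite_finite_induct) (auto intro: has_sum_add)

section \<open>Fourier series as graph lattice sums\<close>

definition edge_graph :: "(nat, nat) pre_digraph" where
  "edge_graph = \<lparr>verts = {0, 1}, arcs = {0}, tail = (\<lambda>_. 0), head = (\<lambda>_. 1)\<rparr>"

lemma connected_edge_graph: "Digraph_Component.connected edge_graph"
proof -
  let ?H = "with_proj (mk_symmetric edge_graph)"
  have arcs: "arcs_ends ?H = {(0, 1), (1, 0)}" and verts: "verts ?H = {0, 1}"
    by (auto simp: edge_graph_def mk_symmetric_def arcs_ends_def arc_to_ends_def)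
  have "u \<rightarrow>\<^sup>*\<^bsub>?H\<^esub> v" if "u \<in> verts ?H" "v \<in> verts ?H" for u v
  proof (cases "u = v")
    case True
    then show ?thesis
      using that by (simp add: reachable_def)
  next
    case False
    then have "(u, v) \<in> arcs_ends ?H"
      using that unfolding arcs verts by auto
    then show ?thesis
      using that unfolding reachable_def by (meson rtrancl_on_refl rtrancl_on_into_rtrancl_on)
  qed
  then show ?thesis
    unfolding Digraph_Component.connected_def strongly_connected_def using verts by blast
qed

lemma infsum_singleton_PiE: "(\<Sum>\<^sub>\<infinity>x\<in>{v} \<rightarrow>\<^sub>E B. h (x v)) = (\<Sum>\<^sub>\<infinity>z\<in>B. h z)"
  by (rule infsum_reindex_bij_witness[where i = "\<lambda>z. \<lambda>u\<in>{v}. z" and j = "\<lambda>x. x v"])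
    (auto simp: PiE_def extensional_def fun_eq_iff)

text \<open>
  With one end of the edge pinned at \<open>y\<close>, the only free position \<open>x\<close> ranges over the lattice, and the summand
  depends on the edge vector alone, which is \<open>x - y\<close> or \<open>y - x\<close>.  Both substitutions permute the lattice.
\<close>

lemma is_graph_lattice_sum_lattice_fourier:
  fixes A :: "real^'n^'n"
  assumes "l1_kernel A K"
  shows "is_graph_lattice_sum A (lattice_fourier A K)"
proof -
  define h where "h k z = lattice_char k z * K z" for k z
  have fourier: "lattice_fourier A K k = (\<Sum>\<^sub>\<infinity>z\<in>lattice A. h k z)" for k
    by (simp add: lattice_fourier_def h_def mult.commute)
  have graph: "kernel_graph A edge_graph (\<lambda>_. K) 0 1"
    unfolding kernel_graph_def using assms connected_edge_graph
    by (auto simp: edge_graph_def intro!: fin_digraph.intro loopfree_digraph.intro wf_digraph.intro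
        fin_digraph_axioms.intro loopfree_digraph_axioms.intro)
  have "lattice_fourier A K k = graph_lattice_sum A edge_graph (\<lambda>_. K) 0 1 p y k"
    if p: "p \<in> verts edge_graph" and y: "y \<in> lattice A" for p y k
  proof -
    from p consider "p = 0" | "p = 1"
      by (auto simp: edge_graph_def)
    then show ?thesis
    proof cases
      case 1
      then have "graph_lattice_sum A edge_graph (\<lambda>_. K) 0 1 p y k
          = (\<Sum>\<^sub>\<infinity>x\<in>{1::nat} \<rightarrow>\<^sub>E lattice A. h k (x 1 - y))"
        by (simp add: graph_lattice_sum_def edge_graph_def h_def del: One_nat_def)
      also have "\<dots> = (\<Sum>\<^sub>\<infinity>z\<in>lattice A. h k (z - y))"
        by (rule infsum_singleton_PiE)
      also have "\<dots> = (\<Sum>\<^sub>\<infinity>z\<in>lattice A. h k z)"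
        by (rule infsum_reindex_bij_witness[where i = "\<lambda>z. z + y" and j = "\<lambda>z. z - y"])
          (auto simp: lattice_add lattice_diff y)
      finally show ?thesis
        by (simp add: fourier)
    next
      case 2
      then have "graph_lattice_sum A edge_graph (\<lambda>_. K) 0 1 p y k
          = (\<Sum>\<^sub>\<infinity>x\<in>{0::nat} \<rightarrow>\<^sub>E lattice A. h k (y - x 0))"
        by (simp add: graph_lattice_sum_def edge_graph_def h_def insert_Diff_if)
      also have "\<dots> = (\<Sum>\<^sub>\<infinity>z\<in>lattice A. h k (y - z))"
        by (rule infsum_singleton_PiE)
      also have "\<dots> = (\<Sum>\<^sub>\<infinity>z\<in>lattice A. h k z)"
        by (rule infsum_reindex_bij_witness[where i = "\<lambda>z. y - z" and j = "\<lambda>z. y - z"])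
          (auto simp: lattice_diff y)
      finally show ?thesis
        by (simp add: fourier)
    qed
  qed
  with graph show ?thesis
    unfolding is_graph_lattice_sum_def by blast
qed

section \<open>Convolution of semi-analytic sums\<close>

theorem theorem6p2:
  fixes A :: "real^'n^'n"
    and G1 :: "('v1, 'e1) pre_digraph" and G2 :: "('v2, 'e2) pre_digraph"
    and K1 :: "'e1 \<Rightarrow> real^'n \<Rightarrow> complex" and K2 :: "'e2 \<Rightarrow> real^'n \<Rightarrow> complex"
    and s1 t1 p1 :: 'v1 and s2 t2 p2 :: 'v2
    and y1 y2 :: "real^'n"
    and Z1 Z2 :: "real^'n \<Rightarrow> complex"
    and a1 a2 a3 :: "real^'n \<Rightarrow> complex"
    and N1 N2 :: nat
    and b1 b2 \<nu>1 \<nu>2 :: "nat \<Rightarrow> complex"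
    and C1 C2 \<gamma>1 \<gamma>2 :: real
  assumes "invertible A"
    and "kernel_graph A G1 K1 s1 t1" and "p1 \<in> verts G1" and "y1 \<in> lattice A"
    and "kernel_graph A G2 K2 s2 t2" and "p2 \<in> verts G2" and "y2 \<in> lattice A"
    and "Z1 = graph_lattice_sum A G1 K1 s1 t1 p1 y1"
    and "Z2 = graph_lattice_sum A G2 K2 s2 t2 p2 y2"
    and "fourier_representation A Z1 a1 N1 b1 \<nu>1"
    and "fourier_representation A Z2 a2 N2 b2 \<nu>2"
    and "\<gamma>1 > real CARD('n)" and "C1 > 0"
    and "\<forall>x\<in>lattice A - {0}. norm (a1 x) \<le> C1 * norm x powr (- \<gamma>1)"
    and "\<gamma>2 > real CARD('n)" and "C2 > 0"
    and "\<forall>x\<in>lattice A - {0}. norm (a2 x) \<le> C2 * norm x powr (- \<gamma>2)"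
    and "\<forall>x. a3 x = a1 x * a2 x
               + a1 x * (\<Sum>j=1..N2. b2 j * power_kernel (\<nu>2 j) x)
               + a2 x * (\<Sum>i=1..N1. b1 i * power_kernel (\<nu>1 i) x)"
  shows "semi_analytic_sum A (BZ_convolution A Z1 Z2) \<and>
    (\<forall>k. BZ_convolution A Z1 Z2 k =
       (\<Sum>\<^sub>\<infinity>x\<in>lattice A. a3 x * lattice_char k x)
       + (\<Sum>i=1..N1. \<Sum>j=1..N2. b1 i * b2 j * epstein_zeta A (\<nu>1 i + \<nu>2 j) k)) \<and>
    (\<forall>i\<in>{1..N1}. \<forall>j\<in>{1..N2}.
       Re (\<nu>1 i + \<nu>2 j) > 2 * real CARD('n) \<and> 2 * real CARD('n) > real CARD('n)) \<and>
    even_on_lattice A a3 \<and>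
    (\<exists>\<gamma>3::real.
       ereal \<gamma>3 = min (ereal (\<gamma>1 + \<gamma>2))
                    (min (ereal \<gamma>1 + (INF j\<in>{1..N2}. ereal (Re (\<nu>2 j))))
                         (ereal \<gamma>2 + (INF i\<in>{1..N1}. ereal (Re (\<nu>1 i))))) \<and>
       (\<exists>C3>0. \<forall>x\<in>lattice A - {0}. norm (a3 x) \<le> C3 * norm x powr (- \<gamma>3)) \<and>
       (\<gamma>1 \<ge> real CARD('n) + 2 \<and> \<gamma>2 \<ge> real CARD('n) + 2 \<longrightarrow> \<gamma>3 \<ge> real CARD('n) + 2))"
proof -
  let ?d = "real CARD('n)"
  have inv: "invertible A"
    by (rule assms(1))
  obtain L1 where L1: "l1_kernel A L1" "kernel_representation A L1 a1 N1 b1 \<nu>1"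
    and Z1: "\<And>k. Z1 k = lattice_fourier A L1 k"
    using \<open>fourier_representation A Z1 a1 N1 b1 \<nu>1\<close> by (auto simp: fourier_representation_def)
  obtain L2 where L2: "l1_kernel A L2" "kernel_representation A L2 a2 N2 b2 \<nu>2"
    and Z2: "\<And>k. Z2 k = lattice_fourier A L2 k"
    using \<open>fourier_representation A Z2 a2 N2 b2 \<nu>2\<close> by (auto simp: fourier_representation_def)
  have re1: "Re (\<nu>1 i) > ?d" if "i \<in> {1..N1}" for i
    using L1(2) that by (auto simp: kernel_representation_def)
  have re2: "Re (\<nu>2 j) > ?d" if "j \<in> {1..N2}" for j
    using L2(2) that by (auto simp: kernel_representation_def)
  have even1: "a1 (- x) = a1 x" and even2: "a2 (- x) = a2 x" if "x \<in> lattice A" for x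
    using L1(2) L2(2) that by (auto simp: kernel_representation_def even_on_lattice_def)
  have a3: "a3 x = a1 x * a2 x + (\<Sum>j=1..N2. a1 x * (b2 j * power_kernel (\<nu>2 j) x))
      + (\<Sum>i=1..N1. a2 x * (b1 i * power_kernel (\<nu>1 i) x))" for x
    using assms(18) by (simp add: sum_distrib_left)
  define P where "P x = L1 x * L2 x" for x
  define S where "S x = (\<Sum>i=1..N1. \<Sum>j=1..N2. b1 i * b2 j * power_kernel (\<nu>1 i + \<nu>2 j) x)"
    for x :: "real^'n"

  have P_eq: "P x = a3 x + S x" if "x \<in> lattice A" for x
  proof -
    let ?S1 = "\<Sum>i=1..N1. b1 i * power_kernel (\<nu>1 i) x"
    let ?S2 = "\<Sum>j=1..N2. b2 j * power_kernel (\<nu>2 j) x"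
    have "L1 x = a1 x + ?S1" "L2 x = a2 x + ?S2"
      using L1(2) L2(2) that by (auto simp: kernel_representation_def)
    moreover have "S x = ?S1 * ?S2"
      by (simp add: S_def sum_product power_kernel_mult[symmetric] mult_ac)
    ultimately show ?thesis
      using assms(18) by (simp add: P_def algebra_simps)
  qed
  have P_l1: "l1_kernel A P"
    unfolding P_def using L1(1) L2(1) by (rule l1_kernel_mult)
  have Z: "BZ_convolution A Z1 Z2 k = lattice_fourier A P k" for k
  proof -
    have "Z1 = lattice_fourier A L1" "Z2 = lattice_fourier A L2"
      using Z1 Z2 by auto
    then show ?thesis
      using BZ_convolution_lattice_fourier[OF inv L1(1) L2(1)] by (simp add: P_def[abs_def])
  qed
  have re12: "Re (\<nu>1 i + \<nu>2 j) > 2 * ?d" if "i \<in> {1..N1}" "j \<in> {1..N2}" for i j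
    using re1[OF that(1)] re2[OF that(2)] by simp

  have formula: "BZ_convolution A Z1 Z2 k = (\<Sum>\<^sub>\<infinity>x\<in>lattice A. a3 x * lattice_char k x)
      + (\<Sum>i=1..N1. \<Sum>j=1..N2. b1 i * b2 j * epstein_zeta A (\<nu>1 i + \<nu>2 j) k)" for k
  proof -
    let ?E = "\<Sum>i=1..N1. \<Sum>j=1..N2. b1 i * b2 j * epstein_zeta A (\<nu>1 i + \<nu>2 j) k"
    have "((\<lambda>x. b1 i * b2 j * (power_kernel (\<nu>1 i + \<nu>2 j) x * lattice_char k x))
        has_sum b1 i * b2 j * epstein_zeta A (\<nu>1 i + \<nu>2 j) k) (lattice A)"
      if "i \<in> {1..N1}" "j \<in> {1..N2}" for i j
    proof -
      have "l1_kernel A (power_kernel (\<nu>1 i + \<nu>2 j))"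
        using re12[OF that] by (intro l1_kernel_power_kernel inv) auto
      moreover have "epstein_zeta A (\<nu>1 i + \<nu>2 j) k = lattice_fourier A (power_kernel (\<nu>1 i + \<nu>2 j)) k"
        by (simp add: epstein_zeta_def lattice_fourier_def mult.commute)
      ultimately show ?thesis
        using l1_kernel_fourier_has_sum by (intro has_sum_cmult_right) simp
    qed
    then have "((\<lambda>x. \<Sum>i=1..N1. \<Sum>j=1..N2. b1 i * b2 j * (power_kernel (\<nu>1 i + \<nu>2 j) x * lattice_char k x))
        has_sum ?E) (lattice A)"
      by (intro has_sum_finite_sum)
    then have "((\<lambda>x. S x * lattice_char k x) has_sum ?E) (lattice A)"
      by (simp add: S_def sum_distrib_right mult.assoc)
    then have "((\<lambda>x. - (S x * lattice_char k x)) has_sum - ?E) (lattice A)"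
      by (simp add: has_sum_uminus)
    from has_sum_add[OF l1_kernel_fourier_has_sum[OF P_l1] this]
    have "((\<lambda>x. P x * lattice_char k x - S x * lattice_char k x) has_sum
        (lattice_fourier A P k - ?E)) (lattice A)"
      by simp
    also have "?this \<longleftrightarrow> ((\<lambda>x. a3 x * lattice_char k x) has_sum (lattice_fourier A P k - ?E)) (lattice A)"
      by (intro has_sum_cong) (simp add: P_eq ring_distribs)
    finally show ?thesis
      by (simp add: infsumI Z)
  qed

  have even3: "even_on_lattice A a3"
    unfolding even_on_lattice_def by (simp add: a3 even1 even2 power_kernel_minus)

  \<comment> \<open>Stated for arbitrary rates of \<open>a1\<close> and \<open>a2\<close>, since it is needed for the representation of the
    product kernel (rate \<open>d + 2\<close>) as well as for the sharp exponent.\<close>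
  have decay3: "lattice_decay A \<gamma> a3"
    if a: "lattice_decay A \<delta>1 a1" "lattice_decay A \<delta>2 a2" and "\<gamma> \<le> \<delta>1 + \<delta>2"
      and le2: "\<And>j. j \<in> {1..N2} \<Longrightarrow> \<gamma> \<le> \<delta>1 + Re (\<nu>2 j)"
      and le1: "\<And>i. i \<in> {1..N1} \<Longrightarrow> \<gamma> \<le> \<delta>2 + Re (\<nu>1 i)"
    for \<gamma> \<delta>1 \<delta>2
  proof -
    have "lattice_decay A \<gamma> (\<lambda>x. a1 x * a2 x)"
      by (rule lattice_decay_mono[OF inv lattice_decay_mult[OF a]]) fact
    moreover have "lattice_decay A \<gamma> (\<lambda>x. a1 x * (b2 j * power_kernel (\<nu>2 j) x))" if "j \<in> {1..N2}" for j
      by (rule lattice_decay_mono[OF inv lattice_decay_mult[OF a(1) lattice_decay_power_kernel]]) (rule le2[OF that])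
    moreover have "lattice_decay A \<gamma> (\<lambda>x. a2 x * (b1 i * power_kernel (\<nu>1 i) x))" if "i \<in> {1..N1}" for i
      by (rule lattice_decay_mono[OF inv lattice_decay_mult[OF a(2) lattice_decay_power_kernel]]) (rule le1[OF that])
    ultimately show ?thesis
      unfolding a3[abs_def] by (intro lattice_decay_add lattice_decay_sum)
  qed

  have semi: "semi_analytic_sum A (BZ_convolution A Z1 Z2)"
  proof -
    have "lattice_decay A (?d + 2) a1" "lattice_decay A (?d + 2) a2"
      using L1(2) L2(2) by (auto simp: kernel_representation_def lattice_decay_def)
    then have "lattice_decay A (?d + 2) a3"
      by (rule decay3) (use re1 re2 in \<open>force+\<close>)
    then obtain C where C: "C > 0" "\<forall>x\<in>lattice A - {0}. norm (a3 x) \<le> C * norm x powr (- (?d + 2))"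
      by (elim lattice_decayE) auto
    \<comment> \<open>A representation lists its exponents along an initial segment of the naturals, so the pairs
      \<open>(i, j)\<close> have to be enumerated.\<close>
    obtain h where h: "bij_betw h {1..N1 * N2} ({1..N1} \<times> {1..N2})"
      using ex_bij_betw_nat_finite_1[of "{1..N1} \<times> {1..N2}"] by auto
    define b where "b l = b1 (fst (h l)) * b2 (snd (h l))" for l
    define \<nu> where "\<nu> l = \<nu>1 (fst (h l)) + \<nu>2 (snd (h l))" for l
    have "S x = (\<Sum>l=1..N1 * N2. b l * power_kernel (\<nu> l) x)" for x
      using sum.reindex_bij_betw[OF h, of "\<lambda>(i, j). b1 i * b2 j * power_kernel (\<nu>1 i + \<nu>2 j) x"]
      by (simp add: S_def sum.cartesian_product b_def \<nu>_def case_prod_beta)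
    moreover have "Re (\<nu> l) > ?d" if "l \<in> {1..N1 * N2}" for l
    proof -
      have "h l \<in> {1..N1} \<times> {1..N2}"
        using bij_betwE[OF h] that by blast
      then have "Re (\<nu> l) > 2 * ?d"
        unfolding \<nu>_def by (intro re12) auto
      then show ?thesis
        by linarith
    qed
    ultimately have "kernel_representation A P a3 (N1 * N2) b \<nu>"
      unfolding kernel_representation_def using P_eq even3 C by auto
    then have "semi_analytic_kernel A P"
      unfolding semi_analytic_kernel_def using P_l1 by blast
    moreover have "BZ_convolution A Z1 Z2 = lattice_fourier A P"
      using Z by auto
    ultimately show ?thesis
      unfolding semi_analytic_sum_def using is_graph_lattice_sum_lattice_fourier[OF P_l1] by auto
  qed

  have exponent: "\<exists>\<gamma>3::real.
       ereal \<gamma>3 = min (ereal (\<gamma>1 + \<gamma>2))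
                    (min (ereal \<gamma>1 + (INF j\<in>{1..N2}. ereal (Re (\<nu>2 j))))
                         (ereal \<gamma>2 + (INF i\<in>{1..N1}. ereal (Re (\<nu>1 i))))) \<and>
       (\<exists>C3>0. \<forall>x\<in>lattice A - {0}. norm (a3 x) \<le> C3 * norm x powr (- \<gamma>3)) \<and>
       (\<gamma>1 \<ge> ?d + 2 \<and> \<gamma>2 \<ge> ?d + 2 \<longrightarrow> \<gamma>3 \<ge> ?d + 2)"
  proof -
    let ?I2 = "INF j\<in>{1..N2}. ereal (Re (\<nu>2 j))" and ?I1 = "INF i\<in>{1..N1}. ereal (Re (\<nu>1 i))"
    define E where "E = min (ereal (\<gamma>1 + \<gamma>2)) (min (ereal \<gamma>1 + ?I2) (ereal \<gamma>2 + ?I1))"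
    \<comment> \<open>A real lower bound of the exponent: it excludes the value \<open>-\<infinity>\<close> and gives the bound by \<open>d + 2\<close>.
      The bound from above is \<open>\<gamma>1 + \<gamma>2\<close>, also when both index sets are empty and the infima infinite.\<close>
    define m where "m = min (\<gamma>1 + \<gamma>2) (min (\<gamma>1 + ?d) (\<gamma>2 + ?d))"
    have m: "m \<le> \<gamma>1 + \<gamma>2" "m \<le> \<gamma>1 + ?d" "m \<le> \<gamma>2 + ?d"
      by (auto simp: m_def)
    have "ereal ?d \<le> ?I2" "ereal ?d \<le> ?I1"
      by (intro INF_greatest; use re1 re2 in \<open>simp add: less_imp_le\<close>)+
    then have "ereal \<gamma>1 + ereal ?d \<le> ereal \<gamma>1 + ?I2" "ereal \<gamma>2 + ereal ?d \<le> ereal \<gamma>2 + ?I1"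
      by - (rule add_left_mono, assumption)+
    moreover have "ereal m \<le> ereal \<gamma>1 + ereal ?d" "ereal m \<le> ereal \<gamma>2 + ereal ?d"
      using m by simp_all
    ultimately have "ereal m \<le> ereal \<gamma>1 + ?I2" "ereal m \<le> ereal \<gamma>2 + ?I1"
      by (blast intro: order_trans)+
    then have lower: "ereal m \<le> E"
      unfolding E_def using m(1) by simp
    have upper: "E \<le> ereal (\<gamma>1 + \<gamma>2)" "E \<le> ereal \<gamma>1 + ?I2" "E \<le> ereal \<gamma>2 + ?I1"
      unfolding E_def by (auto intro: min.coboundedI1 min.coboundedI2)
    obtain \<gamma>3 where \<gamma>3: "E = ereal \<gamma>3"
      using lower upper(1) by (cases E) auto
    have lb: "m \<le> \<gamma>3" and g: "\<gamma>3 \<le> \<gamma>1 + \<gamma>2"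
      using lower upper(1) unfolding \<gamma>3 by simp_all
    have "\<gamma>3 \<le> \<gamma>1 + Re (\<nu>2 j)" if "j \<in> {1..N2}" for j
    proof -
      have "ereal \<gamma>3 \<le> ereal \<gamma>1 + ?I2"
        using upper(2) by (simp only: \<gamma>3)
      also have "\<dots> \<le> ereal \<gamma>1 + ereal (Re (\<nu>2 j))"
        using that by (intro add_left_mono INF_lower)
      finally show ?thesis
        by simp
    qed
    moreover have "\<gamma>3 \<le> \<gamma>2 + Re (\<nu>1 i)" if "i \<in> {1..N1}" for i
    proof -
      have "ereal \<gamma>3 \<le> ereal \<gamma>2 + ?I1"
        using upper(3) by (simp only: \<gamma>3)
      also have "\<dots> \<le> ereal \<gamma>2 + ereal (Re (\<nu>1 i))"
        using that by (intro add_left_mono INF_lower)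
      finally show ?thesis
        by simp
    qed
    moreover have "lattice_decay A \<gamma>1 a1" "lattice_decay A \<gamma>2 a2"
      using assms(14,17) by (auto simp: lattice_decay_def)
    ultimately have "lattice_decay A \<gamma>3 a3"
      using g by (intro decay3)
    then have "\<exists>C3>0. \<forall>x\<in>lattice A - {0}. norm (a3 x) \<le> C3 * norm x powr (- \<gamma>3)"
      by (elim lattice_decayE) auto
    moreover have "?d + 2 \<le> \<gamma>3" if "\<gamma>1 \<ge> ?d + 2" "\<gamma>2 \<ge> ?d + 2"
    proof -
      have "?d + 2 \<le> m"
        using that by (simp add: m_def)
      with lb show ?thesis
        by linarith
    qed
    ultimately show ?thesis
      unfolding E_def[symmetric] \<gamma>3 by (intro exI[of _ \<gamma>3]) simp
  qed

  show ?thesis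
    by (intro conjI allI ballI semi formula re12 even3 exponent) auto
qed

end
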